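(* Let $G=\langle X\rangle$ be a word hyperbolic group, where $X$ is a finite inverse-closed generating set equipped with a total ordering. Then $\mathsf{ConjGeo}(G,X)$ and $\mathsf{ConjMinLenSL}(G,X)$ are regular languages.
   Context: For $w\in X^*$, $l(w)$ is its length and $\pi(w)$ the element of $G$ it represents. For $g\in G$, $|g|$ is the length of a shortest word over $X$ representing $g$, and $|g|_c=\min\{|h| : h\text{ conjugate to }g\text{ in }G\}$. $\mathsf{ConjGeo}(G,X)=\{w\in X^* : l(w)=|\pi(w)|_c\}$. Given a total ordering of $X$, the shortlex ordering on $X^*$ compares words first by length and then, for equal length, lexicographically; $y_g$ denotes the shortlex least word representing $g$. $\mathsf{ConjMinLenSL}(G,X)=\{y_g : g\in G,\ |g|=|g|_c\}$. A language is regular if it is accepted by a finite state automaton. *)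

theory Defs
  imports "HOL-Algebra.Generated_Groups"
begin

definition fin_inv_gen_set :: "('a, 'b) monoid_scheme \<Rightarrow> 'a set \<Rightarrow> bool" where
  "fin_inv_gen_set G X \<longleftrightarrow>
     finite X \<and> X \<subseteq> carrier G \<and> (\<forall>x\<in>X. inv\<^bsub>G\<^esub> x \<in> X) \<and> generate G X = carrier G"

definition word_val :: "('a, 'b) monoid_scheme \<Rightarrow> 'a list \<Rightarrow> 'a" where
  "word_val G w = foldr (\<lambda>x y. x \<otimes>\<^bsub>G\<^esub> y) w \<one>\<^bsub>G\<^esub>"

definition word_norm :: "('a, 'b) monoid_scheme \<Rightarrow> 'a set \<Rightarrow> 'a \<Rightarrow> nat" where
  "word_norm G X g = (LEAST n. \<exists>w\<in>lists X. word_val G w = g \<and> length w = n)"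

definition conj_in :: "('a, 'b) monoid_scheme \<Rightarrow> 'a \<Rightarrow> 'a \<Rightarrow> bool" where
  "conj_in G g h \<longleftrightarrow> (\<exists>x\<in>carrier G. h = x \<otimes>\<^bsub>G\<^esub> g \<otimes>\<^bsub>G\<^esub> inv\<^bsub>G\<^esub> x)"

definition conj_norm :: "('a, 'b) monoid_scheme \<Rightarrow> 'a set \<Rightarrow> 'a \<Rightarrow> nat" where
  "conj_norm G X g = (LEAST n. \<exists>h\<in>carrier G. conj_in G g h \<and> word_norm G X h = n)"

text \<open>The Cayley graph of \<open>G\<close> with respect to \<open>X\<close> enters through its path metric on vertices
  (the word metric) and its geodesic edge paths, given by their lists of vertices.\<close>

definition cayley_dist :: "('a, 'b) monoid_scheme \<Rightarrow> 'a set \<Rightarrow> 'a \<Rightarrow> 'a \<Rightarrow> nat" where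
  "cayley_dist G X g h = word_norm G X (inv\<^bsub>G\<^esub> g \<otimes>\<^bsub>G\<^esub> h)"

definition cayley_geodesic ::
  "('a, 'b) monoid_scheme \<Rightarrow> 'a set \<Rightarrow> 'a \<Rightarrow> 'a \<Rightarrow> 'a list \<Rightarrow> bool" where
  "cayley_geodesic G X g h ps \<longleftrightarrow>
     ps \<noteq> [] \<and> set ps \<subseteq> carrier G \<and> hd ps = g \<and> last ps = h \<and>
     (\<forall>i j. i \<le> j \<and> j < length ps \<longrightarrow> cayley_dist G X (ps ! i) (ps ! j) = j - i)"

text \<open>Geodesic triangles are \<open>\<delta>\<close>-slim: each side lies in the \<open>\<delta>\<close>-neighbourhood of the union of
  the other two. As \<open>p\<close>, \<open>q\<close>, \<open>r\<close> and the sides are arbitrary (and reversed geodesics are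
  geodesics), it is enough to name one side. Corners and points on the sides range over vertices
  only; allowing points in the interior of edges changes \<open>\<delta>\<close> by a bounded amount, so it does not
  affect the existence of \<open>\<delta>\<close>.\<close>

definition cayley_slim_triangles :: "('a, 'b) monoid_scheme \<Rightarrow> 'a set \<Rightarrow> nat \<Rightarrow> bool" where
  "cayley_slim_triangles G X \<delta> \<longleftrightarrow>
     (\<forall>p q r a b c. cayley_geodesic G X p q a \<and> cayley_geodesic G X q r b \<and>
        cayley_geodesic G X p r c \<longrightarrow>
        (\<forall>u\<in>set a. \<exists>v\<in>set b \<union> set c. cayley_dist G X u v \<le> \<delta>))"

text \<open>Being word hyperbolic is a property of the group alone, so the generating set for which the
  Cayley graph is hyperbolic is existentially quantified.\<close>

definition word_hyperbolic :: "('a, 'b) monoid_scheme \<Rightarrow> bool" where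
  "word_hyperbolic G \<longleftrightarrow>
     group G \<and> (\<exists>Y \<delta>. fin_inv_gen_set G Y \<and> cayley_slim_triangles G Y \<delta>)"

definition ConjGeo :: "('a, 'b) monoid_scheme \<Rightarrow> 'a set \<Rightarrow> 'a list set" where
  "ConjGeo G X = {w \<in> lists X. length w = conj_norm G X (word_val G w)}"

text \<open>\<open>r\<close> is a reflexive total order, so \<open>r - Id\<close> is its strict part and \<open>lenlex (r - Id)\<close> is the
  strict shortlex order.\<close>

definition shortlex_rep ::
  "('a, 'b) monoid_scheme \<Rightarrow> 'a set \<Rightarrow> ('a \<times> 'a) set \<Rightarrow> 'a \<Rightarrow> 'a list" where
  "shortlex_rep G X r g =
     (THE w. w \<in> lists X \<and> word_val G w = g \<and>
        (\<forall>v\<in>lists X. word_val G v = g \<and> v \<noteq> w \<longrightarrow> (w, v) \<in> lenlex (r - Id)))"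

definition ConjMinLenSL ::
  "('a, 'b) monoid_scheme \<Rightarrow> 'a set \<Rightarrow> ('a \<times> 'a) set \<Rightarrow> 'a list set" where
  "ConjMinLenSL G X r =
     {shortlex_rep G X r g | g. g \<in> carrier G \<and> word_norm G X g = conj_norm G X g}"

text \<open>Acceptance by a finite deterministic automaton over the alphabet \<open>A\<close>. The states are natural
  numbers, which is no restriction since the state set \<open>Q\<close> is finite.\<close>

definition regular_language :: "'c set \<Rightarrow> 'c list set \<Rightarrow> bool" where
  "regular_language A L \<longleftrightarrow>
     (\<exists>(Q :: nat set) step start accepting.
        finite Q \<and> start \<in> Q \<and> accepting \<subseteq> Q \<and> (\<forall>q\<in>Q. \<forall>x\<in>A. step q x \<in> Q) \<and>
        L = {w \<in> lists A. foldl step start w \<in> accepting})"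

end

theory Submission
  imports Defs
begin

text \<open>
  Slimness of triangles passes from one finite generating set to another by the Morse lemma. In a
  slim Cayley graph there is a constant \<open>K\<close> such that \<open>u v\<close> fails to be of minimal length in its
  conjugacy class if and only if \<open>|\<gamma>\<inverse> u \<beta>| + |\<beta>\<inverse> v \<gamma>| < l(u) + l(v)\<close> for some \<open>\<beta>, \<gamma>\<close> of norm at
  most \<open>K\<close>. Indeed some cyclic permutation of \<open>u v\<close>, read as a path, fellow travels with a
  strictly shorter path labelled by a conjugate: either it contains a minimal non-geodesic factor,
  or all cyclic permutations are geodesic, and then for a long word a conjugator of minimal length
  between cyclic permutations is short, because the two long sides of the conjugacy
  quadrilateral are everywhere at least its norm apart. So whether \<open>u v\<close> lies in \<open>ConjGeo\<close> depends only on \<open>v\<close> and on the finitely many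
  differences \<open>|\<gamma>\<inverse> u \<beta>| - l(u)\<close>, and \<open>ConjGeo\<close> has finitely many left quotients. For the shortlex
  language one also records the differences \<open>\<beta>\<close> between \<open>u\<close> and the lexicographically smaller
  words of the same length that stay close to it.
\<close>

section \<open>Slim graph metrics\<close>

text \<open>Models the vertices of a connected graph with the path metric, so that word metrics of
  different generating sets can be compared on one set of points. The map in
  \<open>geodesic_ex\<close> is total with all values in \<open>S\<close>, which spares range
  conditions.\<close>

locale graph_metric =
  fixes S :: "'p set" and d :: "'p \<Rightarrow> 'p \<Rightarrow> nat"
  assumes dist_self: "x \<in> S \<Longrightarrow> d x x = 0"
    and dist_0D: "\<lbrakk>x \<in> S; y \<in> S; d x y = 0\<rbrakk> \<Longrightarrow> x = y"
    and dist_sym: "\<lbrakk>x \<in> S; y \<in> S\<rbrakk> \<Longrightarrow> d x y = d y x"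
    and triangle: "\<lbrakk>x \<in> S; y \<in> S; z \<in> S\<rbrakk> \<Longrightarrow> d x z \<le> d x y + d y z"
    and geodesic_ex: "\<lbrakk>x \<in> S; y \<in> S\<rbrakk> \<Longrightarrow> \<exists>f. f 0 = x \<and> f (d x y) = y \<and>
      (\<forall>i. f i \<in> S) \<and> (\<forall>i j. i \<le> j \<longrightarrow> j \<le> d x y \<longrightarrow> d (f i) (f j) = j - i)"
begin

text \<open>Sides of triangles are replaced by the sets of all points lying on some geodesic, so that no
  choice of geodesics enters; \<open>slim\<close> below is phrased with these.\<close>

definition interval :: "'p \<Rightarrow> 'p \<Rightarrow> 'p set" where
  "interval p q = {x \<in> S. d p x + d x q = d p q}"

definition slim :: "nat \<Rightarrow> bool" where
  "slim \<delta> \<longleftrightarrow> (\<forall>p\<in>S. \<forall>q\<in>S. \<forall>r\<in>S. \<forall>x\<in>interval p q.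
     \<exists>y\<in>interval p r \<union> interval r q. d x y \<le> \<delta>)"

definition geodesic :: "(nat \<Rightarrow> 'p) \<Rightarrow> 'p \<Rightarrow> 'p \<Rightarrow> bool" where
  "geodesic f p q \<longleftrightarrow> f 0 = p \<and> f (d p q) = q \<and> (\<forall>i. f i \<in> S) \<and>
     (\<forall>i j. i \<le> j \<longrightarrow> j \<le> d p q \<longrightarrow> d (f i) (f j) = j - i)"

lemma interval_sym: "\<lbrakk>p \<in> S; q \<in> S\<rbrakk> \<Longrightarrow> interval p q = interval q p"
  unfolding interval_def using dist_sym by (auto simp: add.commute)

lemma interval_subset: "interval p q \<subseteq> S"
  unfolding interval_def by auto

text \<open>Concatenate geodesics from \<open>p\<close> to \<open>x\<close> and from
  \<open>x\<close> to \<open>q\<close>: a shortcut between the two halves would make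
  \<open>d p q\<close> smaller than \<open>d p x + d x q\<close>.\<close>

lemma geodesic_through:
  assumes "p \<in> S" "q \<in> S" "x \<in> interval p q"
  obtains f where "geodesic f p q" "f (d p x) = x"
proof -
  have x: "x \<in> S" and b: "d p x + d x q = d p q" using assms by (auto simp: interval_def)
  obtain f1 where f1: "f1 0 = p" "f1 (d p x) = x" "\<And>i. f1 i \<in> S"
    "\<And>i j. i \<le> j \<Longrightarrow> j \<le> d p x \<Longrightarrow> d (f1 i) (f1 j) = j - i"
    using geodesic_ex[OF assms(1) x] by blast
  obtain f2 where f2: "f2 0 = x" "f2 (d x q) = q" "\<And>i. f2 i \<in> S"
    "\<And>i j. i \<le> j \<Longrightarrow> j \<le> d x q \<Longrightarrow> d (f2 i) (f2 j) = j - i"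
    using geodesic_ex[OF x assms(2)] by blast
  define f where "f i = (if i \<le> d p x then f1 i else f2 (i - d p x))" for i
  have "d (f i) (f j) = j - i" if "i \<le> j" "j \<le> d p q" for i j
  proof -
    consider "j \<le> d p x" | "i > d p x" | "i \<le> d p x" "d p x < j" by linarith
    then show ?thesis
    proof cases
      case 1 with that show ?thesis by (simp add: f_def f1)
    next
      case 2 with that b show ?thesis by (simp add: f_def f2)
    next
      case 3
      have a: "d (f1 i) x = d p x - i" using f1(4)[of i "d p x"] 3 by (simp add: f1)
      have c: "d x (f2 (j - d p x)) = j - d p x" using f2(4)[of 0 "j - d p x"] 3 b that
        by (simp add: f2)
      have e: "d p (f1 i) = i" using f1(4)[of 0 i] 3 by (simp add: f1)
      have g: "d (f2 (j - d p x)) q = d p q - j" using f2(4)[of "j - d p x" "d x q"] 3 b that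
        by (simp add: f2)
      have "d (f1 i) (f2 (j - d p x)) \<le> d (f1 i) x + d x (f2 (j - d p x))"
        using triangle f1(3) f2(3) x by blast
      moreover have "d p q \<le> d p (f1 i) + (d (f1 i) (f2 (j - d p x)) + d (f2 (j - d p x)) q)"
        using triangle[of p "f1 i" q] triangle[of "f1 i" "f2 (j - d p x)" q] f1(3) f2(3) assms
        by (meson add_left_mono le_trans)
      ultimately have "d (f1 i) (f2 (j - d p x)) = j - i" using a c e g 3 that b by linarith
      then show ?thesis using 3 by (simp add: f_def)
    qed
  qed
  moreover have "f 0 = p" "f (d p x) = x" "\<And>i. f i \<in> S" by (auto simp: f_def f1 f2)
  moreover have "f (d p q) = q"
  proof (cases "d x q = 0")
    case True then show ?thesis using b f1 f2 by (simp add: f_def)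
  next
    case False
    then have "d p q > d p x" "d p q - d p x = d x q" using b by linarith+
    then show ?thesis by (simp add: f_def f2)
  qed
  ultimately show thesis using that[of f] unfolding geodesic_def by blast
qed

lemma left_endpoint: "\<lbrakk>p \<in> S; q \<in> S\<rbrakk> \<Longrightarrow> p \<in> interval p q"
  by (simp add: interval_def dist_self)

lemma right_endpoint: "\<lbrakk>p \<in> S; q \<in> S\<rbrakk> \<Longrightarrow> q \<in> interval p q"
  by (simp add: interval_def dist_self)

lemma geodesicD:
  assumes "geodesic f p q"
  shows "f 0 = p" "f (d p q) = q" "f i \<in> S" "i \<le> j \<Longrightarrow> j \<le> d p q \<Longrightarrow> d (f i) (f j) = j - i"
  using assms by (auto simp: geodesic_def)

lemma geodesic_interval:
  assumes "geodesic f p q" "i \<le> d p q"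
  shows "f i \<in> interval p q" "d p (f i) = i" "d (f i) q = d p q - i"
proof -
  show a: "d p (f i) = i" using geodesicD(4)[OF assms(1), of 0 i] geodesicD(1)[OF assms(1)] assms by simp
  show b: "d (f i) q = d p q - i"
    using geodesicD(4)[OF assms(1), of i "d p q"] geodesicD(2)[OF assms(1)] assms by simp
  show "f i \<in> interval p q" using a b assms geodesicD(3)[OF assms(1)] by (simp add: interval_def)
qed

lemma interval_point:
  assumes "p \<in> S" "q \<in> S" "i \<le> d p q"
  obtains x where "x \<in> interval p q" "d p x = i" "d x q = d p q - i"
proof -
  obtain f where "geodesic f p q"
    using geodesic_through[OF assms(1,2) left_endpoint[OF assms(1,2)]] by blast
  from geodesic_interval[OF this assms(3)] show thesis by (rule that)
qed

lemma interval_mono: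
  assumes S: "p \<in> S" "q \<in> S" and x: "x \<in> interval p q"
  shows "interval p x \<subseteq> interval p q" "interval x q \<subseteq> interval p q"
proof -
  have xS: "x \<in> S" "d p x + d x q = d p q" using x by (auto simp: interval_def)
  have "d p y + d y q = d p q" if "y \<in> S" "d p y + d y x = d p x" for y
    using triangle[OF S(1) that(1) S(2)] triangle[OF that(1) xS(1) S(2)] xS that by linarith
  then show "interval p x \<subseteq> interval p q" unfolding interval_def by auto
  have "d p y + d y q = d p q" if "y \<in> S" "d x y + d y q = d x q" for y
    using triangle[OF S(1) that(1) S(2)] triangle[OF S(1) xS(1) that(1)] xS that by linarith
  then show "interval x q \<subseteq> interval p q" unfolding interval_def by auto
qed

lemma interval_inner:
  assumes S: "p \<in> S" "q \<in> S" and x: "x \<in> interval p q"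
    and y: "y \<in> interval p x" and z: "z \<in> interval x q"
  shows "x \<in> interval y z"
proof -
  have xS: "x \<in> S" "d p x + d x q = d p q" and yS: "y \<in> S" "d p y + d y x = d p x"
    and zS: "z \<in> S" "d x z + d z q = d x q" using x y z by (auto simp: interval_def)
  have "d p q \<le> d p y + (d y z + d z q)"
    using triangle[OF S(1) yS(1) S(2)] triangle[OF yS(1) zS(1) S(2)] by linarith
  then have "d y x + d x z = d y z" using triangle[OF yS(1) xS(1) zS(1)] xS yS zS by linarith
  then show ?thesis using xS by (simp add: interval_def)
qed

lemma triangle3:
  "\<lbrakk>w \<in> S; x \<in> S; y \<in> S; z \<in> S\<rbrakk> \<Longrightarrow> d w z \<le> d w x + d x y + d y z"
  using triangle[of w y z] triangle[of w x y] by linarith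

lemma slimD:
  assumes "slim \<delta>" "p \<in> S" "q \<in> S" "r \<in> S" "x \<in> interval p q"
  obtains y where "y \<in> interval p r \<or> y \<in> interval r q" "y \<in> S" "d x y \<le> \<delta>"
proof -
  have "\<exists>y\<in>interval p r \<union> interval r q. d x y \<le> \<delta>" using assms unfolding slim_def by blast
  then show thesis using that interval_subset by blast
qed

lemma slim_quadrilateral:
  assumes sl: "slim \<delta>" and S: "p \<in> S" "q \<in> S" "r \<in> S" "s \<in> S" and x: "x \<in> interval p q"
  obtains y where "y \<in> interval p r \<or> y \<in> interval r s \<or> y \<in> interval s q" "y \<in> S" "d x y \<le> 2 * \<delta>"
proof -
  have xS: "x \<in> S" using x interval_subset by blast
  obtain y where y: "y \<in> interval p r \<or> y \<in> interval r q" "y \<in> S" "d x y \<le> \<delta>"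
    using slimD[OF sl S(1,2,3) x] by metis
  show thesis
  proof (cases "y \<in> interval p r")
    case True then show ?thesis using y that by force
  next
    case False
    then have "y \<in> interval r q" using y by simp
    then obtain z where z: "z \<in> interval r s \<or> z \<in> interval s q" "z \<in> S" "d y z \<le> \<delta>"
      using slimD[OF sl S(3,2,4)] by metis
    have "d x z \<le> 2 * \<delta>" using triangle[OF xS y(2) z(2)] y z by linarith
    then show ?thesis using z that by blast
  qed
qed

text \<open>Slimness with third corner \<open>y\<close> moves \<open>x\<close> by at most \<delta>
  to a point on a geodesic that ends or starts at \<open>y\<close>. There the distance to
  \<open>y\<close> is a difference of positions, at most \<open>\<delta> + c\<close>.\<close>

lemma slim_bigon:
  assumes sl: "slim \<delta>" and S: "p \<in> S" "q \<in> S" and x: "x \<in> interval p q" and y: "y \<in> interval p q"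
    and c: "d p x \<le> d p y + c" "d p y \<le> d p x + c"
  shows "d x y \<le> 2 * \<delta> + c"
proof -
  have xS: "x \<in> S" "d p x + d x q = d p q" and yS: "y \<in> S" "d p y + d y q = d p q"
    using x y by (auto simp: interval_def)
  obtain z where z: "z \<in> interval p y \<or> z \<in> interval y q" "z \<in> S" "d x z \<le> \<delta>"
    using slimD[OF sl S yS(1) x] by metis
  have zx: "d z x \<le> \<delta>" using z dist_sym xS by simp
  have "d z y \<le> \<delta> + c"
  proof (cases "z \<in> interval p y")
    case True
    then have "d p z + d z y = d p y" by (simp add: interval_def)
    then show ?thesis using triangle[OF S(1) z(2) xS(1)] zx c by linarith
  next
    case False
    then have "d y z + d z q = d y q" using z by (simp add: interval_def)
    then show ?thesis
      using triangle[OF xS(1) z(2) S(2)] triangle[OF z(2) xS(1) S(2)] z(3) zx c xS(2) yS(2)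
        dist_sym[OF z(2) yS(1)] by linarith
  qed
  then show ?thesis using triangle[OF xS(1) z(2) yS(1)] z by linarith
qed

text \<open>The side of the quadrilateral close to \<open>x\<close> decides. On the opposite side
  positions are compared, which costs \<open>6 * \<delta> + K\<close>; on a side of length at most
  \<open>K\<close> both points are near one corner, and the worst case is
  \<open>4 * \<delta> + 3 * K\<close>. The \<open>min\<close> lets \<open>x'\<close> wait at
  \<open>q'\<close> once the second geodesic has ended.\<close>

lemma slim_fellow_travel:
  assumes sl: "slim \<delta>" and S: "p \<in> S" "q \<in> S" "p' \<in> S" "q' \<in> S"
    and K: "d p p' \<le> K" "d q q' \<le> K"
    and x: "x \<in> interval p q" and x': "x' \<in> interval p' q'"
    and pos: "d p' x' = min (d p x) (d p' q')"
  shows "d x x' \<le> 6 * \<delta> + 3 * K"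
proof -
  have xS: "x \<in> S" "d p x + d x q = d p q" and xS': "x' \<in> S" "d p' x' + d x' q' = d p' q'"
    using x x' by (auto simp: interval_def)
  obtain y where y: "y \<in> interval p p' \<or> y \<in> interval p' q' \<or> y \<in> interval q' q" "y \<in> S" "d x y \<le> 2 * \<delta>"
    using slim_quadrilateral[OF sl S x] by metis
  have syms: "d y x = d x y" "d p' p = d p p'" "d q' q = d q q'" "d y p' = d p' y" "d p' x = d x p'"
    "d x' p' = d p' x'" "d x' q' = d q' x'" "d y q' = d q' y" "d q' x = d x q'"
    using dist_sym S xS xS' y by auto
  consider (1) "y \<in> interval p p'" | (2) "y \<in> interval p' q'" | (3) "y \<in> interval q' q"
    using y by blast
  then show ?thesis
  proof cases
    case 1
    then have b: "d p y + d y p' = d p p'" by (simp add: interval_def)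
    have "d x p' \<le> 2 * \<delta> + d y p'" using triangle[OF xS(1) y(2) S(3)] y by linarith
    moreover have "d p x \<le> d p y + 2 * \<delta>" using triangle[OF S(1) y(2) xS(1)] y syms by linarith
    moreover have "d x x' \<le> d x p' + d p' x'" using triangle xS xS' S by blast
    ultimately show ?thesis using pos K b by linarith
  next
    case 2
    then have b: "d p' y + d y q' = d p' q'" by (simp add: interval_def)
    have "d p' y \<le> K + d p x + 2 * \<delta>" using triangle3[OF S(3,1) xS(1) y(2)] syms K y by linarith
    moreover have "d p x \<le> K + d p' y + 2 * \<delta>"
      using triangle3[OF S(1,3) y(2) xS(1)] syms K y by linarith
    ultimately have "d y x' \<le> 2 * \<delta> + (K + 2 * \<delta>)"
      using pos b by (intro slim_bigon[OF sl S(3,4) 2 x']) linarith+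
    then show ?thesis using triangle[OF xS(1) y(2) xS'(1)] y by linarith
  next
    case 3
    then have b: "d q' y + d y q = d q q'" using syms(3) by (auto simp: interval_def)
    have 1: "d x q' \<le> 2 * \<delta> + d q' y" using triangle[OF xS(1) y(2) S(4)] y syms by linarith
    have 2: "d p' q' \<le> K + d p x + d x q'" using triangle3[OF S(3,1) xS(1) S(4)] syms K by linarith
    have "d q' x' \<le> d q' y + 2 * \<delta> + K"
      using pos xS'(2) syms 1 2 by linarith
    moreover have "d x x' \<le> d x q' + d q' x'" using triangle xS xS' S by blast
    ultimately show ?thesis using 1 b K by linarith
  qed
qed

text \<open>Bisection: each of the \<open>k\<close> halvings of the path costs \<delta> by the
  triangle through the midpoint, until a single step is left. So the distance grows only with the
  logarithm of the number of steps.\<close>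

lemma slim_path:
  assumes sl: "slim \<delta>" and f: "\<And>i. f i \<in> S"
    and "a \<le> b" "b - a \<le> 2 ^ k" "x \<in> interval (f a) (f b)"
    and M: "\<And>i. a \<le> i \<Longrightarrow> i < b \<Longrightarrow> d (f i) (f (Suc i)) \<le> M"
  shows "\<exists>i\<ge>a. i \<le> b \<and> d x (f i) \<le> \<delta> * k + M"
  using assms(3-)
proof (induction k arbitrary: a b x)
  case 0
  have x: "x \<in> S" "d (f a) x + d x (f b) = d (f a) (f b)" using 0 by (auto simp: interval_def)
  have "b = a \<or> b = Suc a" using 0 by auto
  then have "d (f a) (f b) \<le> M" using 0 dist_self f by auto
  then have "d x (f b) \<le> M" using x by linarith
  then show ?case using 0 by auto
next
  case (Suc k)
  define m where "m = (a + b) div 2"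
  have m: "a \<le> m" "m \<le> b" "m - a \<le> 2 ^ k" "b - m \<le> 2 ^ k" using Suc.prems by (auto simp: m_def)
  obtain y where y: "y \<in> interval (f a) (f m) \<or> y \<in> interval (f m) (f b)" "y \<in> S" "d x y \<le> \<delta>"
    using slimD[OF sl f f f Suc.prems(3)] by metis
  have "\<exists>i\<ge>a. i \<le> b \<and> d y (f i) \<le> \<delta> * k + M"
    using y(1)
  proof
    assume "y \<in> interval (f a) (f m)"
    with Suc.IH[OF m(1,3)] Suc.prems(4) m show ?thesis by (meson dual_order.trans order.strict_trans2)
  next
    assume "y \<in> interval (f m) (f b)"
    with Suc.IH[OF m(2,4)] Suc.prems(4) m show ?thesis by (meson dual_order.trans)
  qed
  then obtain i where i: "a \<le> i" "i \<le> b" "d y (f i) \<le> \<delta> * k + M" by blast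
  have "x \<in> S" using Suc.prems interval_subset by blast
  from triangle[OF this y(2) f, of i] have "d x (f i) \<le> \<delta> * Suc k + M" using y i by simp
  then show ?case using i by blast
qed

end

section \<open>The Morse lemma and bi-Lipschitz invariance of slimness\<close>

lemma exp_beats_linear:
  assumes "2 ^ k \<le> A + B * (k::nat)"
  shows "k \<le> 2 * A + 2 * B + 4"
proof (rule ccontr)
  assume n: "\<not> ?thesis"
  have sq: "k * k \<le> 2 ^ k" if "k \<ge> 4" for k :: nat
    using that
  proof (induction k rule: dec_induct)
    case (step n)
    have "3 * n \<le> n * n" using step by simp
    then have "2 * n + 1 \<le> n * n" using step by linarith
    then show ?case using step by simp
  qed simp
  have "k * k \<le> A + B * k" using sq[of k] n assms by linarith
  moreover have "(A + B + 1) * k \<le> k * k" using n by (intro mult_right_mono) auto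
  moreover have "A \<le> A * k" using n by (cases k) auto
  ultimately show False using n by (simp add: algebra_simps)
qed

text \<open>For the least admissible \<open>k\<close>, \<open>2 ^ k\<close> is at most
  \<open>1 + 2 * (C * D)\<close>, hence linear in \<open>k\<close> again, and the exponential wins.
  This closes the Morse argument, where a maximal distance is bounded in terms of its own
  logarithm.\<close>

lemma log_bound:
  fixes A B C :: nat
  shows "\<exists>D0. \<forall>D. (\<forall>k. C * D \<le> 2 ^ k \<longrightarrow> D \<le> A + B * k) \<longrightarrow> D \<le> D0"
proof (intro exI allI impI)
  fix D assume H: "\<forall>k. C * D \<le> 2 ^ k \<longrightarrow> D \<le> A + B * k"
  define k where "k = (LEAST k. C * D \<le> 2 ^ k)"
  have ex: "C * D \<le> 2 ^ (C * D)" by (simp add: less_imp_le)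
  then have k: "C * D \<le> 2 ^ k" unfolding k_def by (rule LeastI)
  then have D: "D \<le> A + B * k" using H by blast
  have "2 ^ k \<le> 1 + 2 * (C * D)"
  proof (cases k)
    case (Suc j)
    then have "\<not> C * D \<le> 2 ^ j" unfolding k_def using not_less_Least by (metis lessI)
    then show ?thesis using Suc by simp
  qed simp
  also have "\<dots> \<le> 1 + 2 * (C * (A + B * k))" using D by simp
  also have "\<dots> = (1 + 2 * (C * A)) + (2 * C * B) * k" by (simp add: algebra_simps)
  finally have "k \<le> 2 * (1 + 2 * (C * A)) + 2 * (2 * C * B) + 4" by (rule exp_beats_linear)
  then have "B * k \<le> B * (2 * (1 + 2 * (C * A)) + 2 * (2 * C * B) + 4)" by simp
  with D show "D \<le> A + B * (2 * (1 + 2 * (C * A)) + 2 * (2 * C * B) + 4)" by linarith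
qed

locale bilipschitz_metrics =
  A: graph_metric S d + B: graph_metric S e
  for S :: "'p set" and d e :: "'p \<Rightarrow> 'p \<Rightarrow> nat" +
  fixes M :: nat
  assumes d_le: "\<lbrakk>x \<in> S; y \<in> S\<rbrakk> \<Longrightarrow> d x y \<le> M * e x y"
    and e_le: "\<lbrakk>x \<in> S; y \<in> S\<rbrakk> \<Longrightarrow> e x y \<le> M * d x y"
begin

lemma geodesic_step: "B.geodesic f p q \<Longrightarrow> i \<le> j \<Longrightarrow> j \<le> e p q \<Longrightarrow> d (f i) (f j) \<le> M * (j - i)"
  using d_le[of "f i" "f j"] B.geodesicD(3,4)[of f p q] by metis

text \<open>Serves both directions from \<open>x\<close>, with \<open>i0\<close> the first or the
  last index. If the end point is met before distance \<open>2 * D\<close>, it lies on the path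
  itself and the crossing is trivial; this is the alternative \<open>y = f i\<close>.\<close>

lemma retreat:
  assumes "p \<in> S" "x \<in> S" "i0 \<le> n" "p = f i0"
    and near: "\<And>y. y \<in> A.interval p x \<Longrightarrow> \<exists>i\<le>n. d y (f i) \<le> D"
  shows "\<exists>y i. y \<in> A.interval p x \<and> i \<le> n \<and> d y (f i) \<le> D \<and> d y x \<le> 2 * D \<and> (y = f i \<or> d y x = 2 * D)"
proof (cases "d p x \<le> 2 * D")
  case True
  have "d p (f i0) \<le> D" using assms A.dist_self by auto
  then show ?thesis using True assms A.left_endpoint by blast
next
  case False
  then obtain y where y: "y \<in> A.interval p x" "d y x = d p x - (d p x - 2 * D)"
    using A.interval_point[OF assms(1,2), of "d p x - 2 * D"] by auto
  then have yx: "d y x = 2 * D" using False by simp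
  obtain i where "i \<le> n" "d y (f i) \<le> D" using near[OF y(1)] by blast
  then show ?thesis using y(1) yx by (intro exI[of _ y] exI[of _ i]) simp
qed

text \<open>\<open>x\<close> is a point of a \<open>d\<close>-geodesic at maximal distance \<open>D\<close> from the path \<open>f\<close>. Going back \<open>2 D\<close> on
  both sides of \<open>x\<close> and crossing over to \<open>f\<close> gives a quadrilateral whose short sides are too far
  from \<open>x\<close>, and whose fourth side is joined by a piece of \<open>f\<close> of length linear in \<open>D\<close>, which comes
  within a distance logarithmic in \<open>D\<close>.\<close>

lemma morse_step:
  assumes sl: "A.slim \<delta>" and g: "B.geodesic f p q"
    and x: "x \<in> A.interval p q" and D: "\<And>i. i \<le> e p q \<Longrightarrow> D \<le> d x (f i)"
    and near: "\<And>y. y \<in> A.interval p q \<Longrightarrow> \<exists>i\<le>e p q. d y (f i) \<le> D"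
    and k: "6 * M * D \<le> 2 ^ k"
  shows "D \<le> (2 * \<delta> + M) + \<delta> * k"
proof -
  note f = B.geodesicD[OF g]
  have S: "p \<in> S" "q \<in> S" using f(3)[of 0] f(3)[of "e p q"] f(1,2) by auto
  have xS: "x \<in> S" "d p x + d x q = d p q" using x by (auto simp: A.interval_def)
  have sub: "A.interval p x \<subseteq> A.interval p q" "A.interval q x \<subseteq> A.interval p q"
    using A.interval_mono[OF S x] A.interval_sym[OF S(2) xS(1)] by auto
  obtain y i where y: "y \<in> A.interval p x" and i: "i \<le> e p q"
      "d y (f i) \<le> D" "d y x \<le> 2 * D" "y = f i \<or> d y x = 2 * D"
    using retreat[of p x 0 "e p q" f D] near sub(1) S xS f(1) by blast
  obtain z j where z: "z \<in> A.interval q x" and j: "j \<le> e p q"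
      "d z (f j) \<le> D" "d z x \<le> 2 * D" "z = f j \<or> d z x = 2 * D"
    using retreat[OF S(2) xS(1) order.refl f(2)[symmetric] near[OF subsetD[OF sub(2)]]] by blast
  have yzS: "y \<in> S" "z \<in> S" using y z A.interval_subset by auto
  have xyz: "x \<in> A.interval y z"
    using A.interval_inner[OF S x y] z A.interval_sym[OF S(2) xS(1)] by blast
  \<comment> \<open>A crossing side can come close to \<open>x\<close> only if \<open>D\<close> is
    small: a trivial crossing is a point of the path, and a proper one has length at most
    \<open>D\<close> and begins \<open>2 * D\<close> away from \<open>x\<close>.\<close>
  have end_case: "D \<le> 2 * \<delta>" if "t \<in> A.interval y (f i)" "i \<le> e p q"
    "d y (f i) \<le> D" "y = f i \<or> d y x = 2 * D" "d x t \<le> 2 * \<delta>" "y \<in> S" for t y i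
  proof (cases "y = f i")
    case True
    then have "d (f i) t = 0" "t \<in> S" using that f(3) A.dist_self by (auto simp: A.interval_def)
    then have "t = f i" using A.dist_0D f(3) by blast
    then show ?thesis using D[OF that(2)] that(5) by simp
  next
    case False
    have t: "t \<in> S" "d y t + d t (f i) = d y (f i)" using that by (auto simp: A.interval_def)
    have "d y x \<le> d y t + d x t" using A.triangle[OF that(6) t(1) xS(1)] A.dist_sym[OF t(1) xS(1)] by simp
    then show ?thesis using False that t by linarith
  qed
  obtain t where t: "t \<in> A.interval y (f i) \<or> t \<in> A.interval (f i) (f j) \<or> t \<in> A.interval (f j) z"
    "t \<in> S" "d x t \<le> 2 * \<delta>"
    using A.slim_quadrilateral[OF sl yzS f(3) f(3) xyz] by metis
  show ?thesis
  proof (cases "t \<in> A.interval (f i) (f j)")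
    case False
    then have "t \<in> A.interval y (f i) \<or> t \<in> A.interval z (f j)"
      using t(1) A.interval_sym[OF f(3) yzS(2)] by blast
    then have "D \<le> 2 * \<delta>" using end_case i j t(3) yzS by blast
    then show ?thesis by simp
  next
    case True
    define a b where "a = min i j" and "b = max i j"
    have ab: "a \<le> b" "b \<le> e p q" using i j by (auto simp: a_def b_def)
    have tab: "t \<in> A.interval (f a) (f b)" and dab: "d (f a) (f b) = d (f i) (f j)"
      using True A.interval_sym[OF f(3) f(3)] A.dist_sym[OF f(3) f(3)]
      by (auto simp: a_def b_def min_def max_def)
    have "d (f i) (f j) \<le> d (f i) y + d y z + d z (f j)" using A.triangle3 f(3) yzS by blast
    moreover have "d y z \<le> d y x + d x z" using A.triangle yzS xS by blast
    \<comment> \<open>Two crossings of at most \<open>D\<close> and two retreats of at most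
      \<open>2 * D\<close>. Times \<open>M\<close>, this bounds the number of steps of
      \<open>f\<close> between the crossings, in the form assumed for \<open>k\<close>.\<close>
    ultimately have "d (f i) (f j) \<le> 6 * D"
      using i j A.dist_sym[OF yzS(1) f(3)] A.dist_sym[OF yzS(2) xS(1)] by simp
    moreover have "b - a \<le> M * d (f a) (f b)" using e_le[OF f(3) f(3), of a b] f(4)[OF ab] by simp
    ultimately have "b - a \<le> M * (6 * D)" using dab mult_le_mono2[of "d (f a) (f b)" "6 * D" M] by linarith
    then have "b - a \<le> 2 ^ k" using k by (simp add: mult.commute mult.left_commute)
    moreover have "d (f l) (f (Suc l)) \<le> M" if "l < b" for l
      using geodesic_step[OF g, of l "Suc l"] ab that by simp
    ultimately obtain l where l: "l \<le> b" "d t (f l) \<le> \<delta> * k + M"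
      using A.slim_path[OF sl f(3) ab(1) _ tab] by metis
    have "D \<le> d x (f l)" using D l ab by simp
    also have "\<dots> \<le> d x t + d t (f l)" using A.triangle xS t f(3) by blast
    finally show ?thesis using t l by simp
  qed
qed

text \<open>Apply \<open>morse_step\<close> at a point of the interval whose distance
  \<open>D\<close> to the path is maximal; \<open>log_bound\<close> bounds \<open>D\<close> by a
  constant chosen before the path.\<close>

lemma morse:
  assumes sl: "A.slim \<delta>"
  shows "\<exists>D0. \<forall>f p q. B.geodesic f p q \<longrightarrow> (\<forall>x\<in>A.interval p q. \<exists>i\<le>e p q. d x (f i) \<le> D0)"
proof -
  obtain D0 where D0: "\<And>D. (\<And>k. (6 * M) * D \<le> 2 ^ k \<Longrightarrow> D \<le> (2 * \<delta> + M) + \<delta> * k) \<Longrightarrow> D \<le> D0"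
    using log_bound[of "6 * M" "2 * \<delta> + M" \<delta>] by blast
  have "\<exists>i\<le>e p q. d x (f i) \<le> D0" if g: "B.geodesic f p q" and x: "x \<in> A.interval p q" for f p q x
  proof -
    note f = B.geodesicD[OF g]
    have S: "p \<in> S" "q \<in> S" using f(3)[of 0] f(3)[of "e p q"] f(1,2) by auto
    define h where "h y = Min ((\<lambda>i. d y (f i)) ` {..e p q})" for y
    have h1: "h y \<le> d y (f i)" if "i \<le> e p q" for y i using that by (auto simp: h_def)
    have h2: "\<exists>i\<le>e p q. d y (f i) = h y" for y
    proof -
      have "h y \<in> (\<lambda>i. d y (f i)) ` {..e p q}" unfolding h_def by (intro Min_in) auto
      then show ?thesis by auto
    qed
    \<comment> \<open>Finiteness of the interval is not at hand, but the distances to the path take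
      only finitely many values, so a maximum exists.\<close>
    have "h y \<le> d p q" if "y \<in> A.interval p q" for y
      using h1[of 0 y] f(1) that A.dist_sym[OF S(1), of y] by (auto simp: A.interval_def)
    then have fin: "finite (h ` A.interval p q)" by (intro finite_subset[OF _ finite_atMost[of "d p q"]]) auto
    define D where "D = Max (h ` A.interval p q)"
    have le: "h y \<le> D" if "y \<in> A.interval p q" for y using fin that by (auto simp: D_def)
    have "D \<in> h ` A.interval p q" unfolding D_def using fin x by (intro Max_in) auto
    then obtain y where y: "y \<in> A.interval p q" "h y = D" by auto
    have "D \<le> D0"
    proof (rule D0)
      fix k assume "6 * M * D \<le> 2 ^ k"
      then show "D \<le> 2 * \<delta> + M + \<delta> * k"
        using morse_step[OF sl g y(1)] h1 h2 le y(2) by metis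
    qed
    then show ?thesis using le[OF x] h2[of x] by (metis le_trans)
  qed
  then show ?thesis by blast
qed

text \<open>A connectedness argument: follow a \<open>d\<close>-geodesic and record nearby indices
  on \<open>f\<close>. When the index first reaches \<open>k\<close>, it was below \<open>k\<close>
  one step earlier, and consecutive indices cannot jump far, so \<open>f k\<close> is close to the
  \<open>d\<close>-geodesic.\<close>

lemma morse_converse:
  assumes g: "B.geodesic f p q" and D0: "\<forall>x\<in>A.interval p q. \<exists>i\<le>e p q. d x (f i) \<le> D0"
    and k: "k \<le> e p q"
  shows "\<exists>x\<in>A.interval p q. d (f k) x \<le> M * (M * (2 * D0 + 1)) + D0"
proof -
  note f = B.geodesicD[OF g]
  have S: "p \<in> S" "q \<in> S" using f(3)[of 0] f(3)[of "e p q"] f(1,2) by auto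
  obtain c where c: "A.geodesic c p q" using A.geodesic_through[OF S A.left_endpoint[OF S]] by blast
  have ci: "c t \<in> A.interval p q" if "t \<le> d p q" for t using A.geodesic_interval(1)[OF c that] .
  \<comment> \<open>The value at the end is fixed to the last index, so that the recorded indices
    are sure to reach \<open>k\<close>.\<close>
  define \<iota> where "\<iota> t = (if t = d p q then e p q else SOME i. i \<le> e p q \<and> d (c t) (f i) \<le> D0)" for t
  have \<iota>: "\<iota> t \<le> e p q \<and> d (c t) (f (\<iota> t)) \<le> D0" if "t \<le> d p q" for t
  proof (cases "t = d p q")
    case True then show ?thesis using f(2) A.geodesicD(2)[OF c] A.dist_self S by (simp add: \<iota>_def)
  next
    case False
    then show ?thesis using someI_ex[OF D0[rule_format, OF ci[OF that]]] by (simp add: \<iota>_def)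
  qed
  define t where "t = (LEAST t. k \<le> \<iota> t)"
  have "k \<le> \<iota> (d p q)" using k by (simp add: \<iota>_def)
  then have t: "k \<le> \<iota> t" "t \<le> d p q" unfolding t_def by (rule LeastI, rule Least_le)
  show ?thesis
  proof (cases t)
    \<comment> \<open>There is no preceding step here; the start \<open>p = f 0\<close> serves as
      the lower neighbour.\<close>
    case 0
    have "d p (f (\<iota> 0)) \<le> D0" using \<iota>[of 0] A.geodesicD(1)[OF c] by simp
    then have "e p (f (\<iota> 0)) \<le> M * (2 * D0 + 1)"
      using e_le[OF S(1) f(3)[of "\<iota> 0"]] mult_le_mono2[of "d p (f (\<iota> 0))" "2 * D0 + 1" M] by linarith
    moreover have "e p (f (\<iota> 0)) = \<iota> 0" using f(4)[of 0 "\<iota> 0"] f(1) \<iota>[of 0] by simp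
    ultimately have "k \<le> M * (2 * D0 + 1)" using t 0 by simp
    then have "M * k \<le> M * (M * (2 * D0 + 1))" by (rule mult_le_mono2)
    moreover have "d (f k) p \<le> M * k"
      using geodesic_step[OF g, of 0 k] k f(1) A.dist_sym[OF f(3) S(1)] by simp
    ultimately have "d (f k) p \<le> M * (M * (2 * D0 + 1)) + D0" by linarith
    then show ?thesis using A.left_endpoint[OF S] by blast
  next
    case (Suc s)
    have s: "\<iota> s < k" using not_less_Least[of s "\<lambda>t. k \<le> \<iota> t"] Suc unfolding t_def by simp
    have sS: "c s \<in> S" "c t \<in> S" using A.geodesicD(3)[OF c] by auto
    have "d (f (\<iota> s)) (f (\<iota> t)) \<le> d (f (\<iota> s)) (c s) + d (c s) (c t) + d (c t) (f (\<iota> t))"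
      by (rule A.triangle3[OF f(3) sS f(3)])
    moreover have "d (c s) (c t) = 1" using A.geodesicD(4)[OF c, of s t] t Suc by simp
    ultimately have "d (f (\<iota> s)) (f (\<iota> t)) \<le> 2 * D0 + 1"
      using \<iota>[of s] \<iota>[of t] t Suc A.dist_sym[OF f(3) sS(1)] by simp
    then have "e (f (\<iota> s)) (f (\<iota> t)) \<le> M * (2 * D0 + 1)" 
      using e_le[OF f(3) f(3)] mult_le_mono2 by (blast intro: le_trans)
    then have "\<iota> t - k \<le> M * (2 * D0 + 1)" using f(4)[of "\<iota> s" "\<iota> t"] s t \<iota> by simp
    then have "M * (\<iota> t - k) \<le> M * (M * (2 * D0 + 1))" by (rule mult_le_mono2)
    moreover have "d (f k) (f (\<iota> t)) \<le> M * (\<iota> t - k)" using geodesic_step[OF g t(1)] \<iota>[OF t(2)] by simp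
    moreover have "d (f k) (c t) \<le> d (f k) (f (\<iota> t)) + d (c t) (f (\<iota> t))"
      using A.triangle[OF f(3) f(3) sS(2)] A.dist_sym[OF f(3) sS(2)] by metis
    ultimately have "d (f k) (c t) \<le> M * (M * (2 * D0 + 1)) + D0" using \<iota>[OF t(2)] by linarith
    then show ?thesis using ci[OF t(2)] by blast
  qed
qed

text \<open>Go from an \<open>e\<close>-geodesic to the \<open>d\<close>-interval
  (\<open>D1\<close>), across the slim \<open>d\<close>-triangle (\<delta>), and back to an
  \<open>e\<close>-geodesic (\<open>D0\<close>); the factor \<open>M\<close> converts the total to
  \<open>e\<close>.\<close>

lemma slim_transfer:
  assumes sl: "A.slim \<delta>"
  shows "\<exists>\<delta>'. B.slim \<delta>'"
proof -
  obtain D0 where D0: "\<And>f p q. B.geodesic f p q \<Longrightarrow> \<forall>x\<in>A.interval p q. \<exists>i\<le>e p q. d x (f i) \<le> D0"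
    using morse[OF sl] by blast
  define D1 where "D1 = M * (M * (2 * D0 + 1)) + D0"
  have "B.slim (M * (D1 + \<delta> + D0))"
    unfolding B.slim_def
  proof (intro ballI)
    fix p q r x assume S: "p \<in> S" "q \<in> S" "r \<in> S" and x: "x \<in> B.interval p q"
    have xS: "x \<in> S" "e p x \<le> e p q" using x by (auto simp: B.interval_def)
    obtain f where f: "B.geodesic f p q" "f (e p x) = x" using B.geodesic_through[OF S(1,2) x] .
    obtain y where y: "y \<in> A.interval p q" "d x y \<le> D1"
      using morse_converse[OF f(1) D0[OF f(1)] xS(2)] f(2) unfolding D1_def by auto
    obtain z where z: "z \<in> A.interval p r \<or> z \<in> A.interval r q" "z \<in> S" "d y z \<le> \<delta>"
      using A.slimD[OF sl S y(1)] by metis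
    have side: "\<exists>w\<in>B.interval a b. d z w \<le> D0" if "a \<in> S" "b \<in> S" "z \<in> A.interval a b" for a b
    proof -
      note ab = that
      obtain h where h: "B.geodesic h a b" using B.geodesic_through[OF ab(1,2) B.left_endpoint[OF ab(1,2)]] by blast
      then show ?thesis using D0[OF h] ab(3) B.geodesic_interval(1)[OF h] by blast
    qed
    obtain w where w: "w \<in> B.interval p r \<union> B.interval r q" "d z w \<le> D0"
      using z(1) side S by blast
    have ywS: "y \<in> S" "w \<in> S" using y(1) w(1) A.interval_subset B.interval_subset by blast+
    have "d x w \<le> D1 + \<delta> + D0" using A.triangle3[OF xS(1) ywS(1) z(2) ywS(2)] y z w by linarith
    then have "e x w \<le> M * (D1 + \<delta> + D0)" 
      using e_le[OF xS(1) ywS(2)] mult_le_mono2 by (blast intro: le_trans)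
    then show "\<exists>y\<in>B.interval p r \<union> B.interval r q. e x y \<le> M * (D1 + \<delta> + D0)" using w by blast
  qed
  then show ?thesis by blast
qed

end

section \<open>Word metrics\<close>

locale word_group = group +
  fixes X :: "'a set"
  assumes generating: "fin_inv_gen_set G X"
begin

abbreviation val :: "'a list \<Rightarrow> 'a" where "val \<equiv> word_val G"

abbreviation N :: "'a \<Rightarrow> nat" where "N \<equiv> word_norm G X"

lemma finite_generators: "finite X"
  and generators_closed: "X \<subseteq> carrier G"
  and generators_inv: "x \<in> X \<Longrightarrow> inv x \<in> X"
  and generate_generators: "generate G X = carrier G"
  using generating by (auto simp: fin_inv_gen_set_def)

lemma val_Nil [simp]: "val [] = \<one>"
  by (simp add: word_val_def)

lemma val_Cons [simp]: "val (x # w) = x \<otimes> val w"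
  by (simp add: word_val_def)

lemma val_closed_carrier: "set w \<subseteq> carrier G \<Longrightarrow> val w \<in> carrier G"
  by (induction w) auto

lemma val_closed [simp]: "w \<in> lists X \<Longrightarrow> val w \<in> carrier G"
  using generators_closed by (intro val_closed_carrier) (auto simp: lists_eq_set)

lemma val_append:
  assumes "u \<in> lists X" "v \<in> lists X"
  shows "val (u @ v) = val u \<otimes> val v"
  using assms(1)
proof (induction u)
  case (Cons x u)
  then have "x \<in> carrier G" using generators_closed by auto
  then show ?case using Cons assms(2) by (simp add: m_assoc)
qed (simp add: assms)

lemma inv_cancel: "\<lbrakk>x \<in> carrier G; y \<in> carrier G\<rbrakk> \<Longrightarrow> inv x \<otimes> (x \<otimes> y) = y"
  and cancel_inv: "\<lbrakk>x \<in> carrier G; y \<in> carrier G\<rbrakk> \<Longrightarrow> x \<otimes> (inv x \<otimes> y) = y"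
  by (simp_all flip: m_assoc)

lemmas group_simps = m_assoc inv_mult_group inv_cancel cancel_inv

lemma word_ex:
  assumes "g \<in> carrier G" shows "\<exists>w\<in>lists X. val w = g"
proof -
  have "g \<in> generate G X" using assms generate_generators by simp
  then show ?thesis
  proof induction
    case one
    then show ?case by (intro bexI[of _ "[]"]) auto
  next
    case (incl h)
    then show ?case using generators_closed by (intro bexI[of _ "[h]"]) auto
  next
    case (inv h)
    then show ?case using generators_closed generators_inv[of h] by (intro bexI[of _ "[inv h]"]) auto
  next
    case (eng g h)
    then obtain u v where "u \<in> lists X" "val u = g" "v \<in> lists X" "val v = h" by auto
    then show ?case by (intro bexI[of _ "u @ v"]) (auto simp: val_append)
  qed
qed

lemma norm_word:
  assumes "g \<in> carrier G"
  obtains w where "w \<in> lists X" "val w = g" "length w = N g"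
proof -
  have "\<exists>n. \<exists>w\<in>lists X. val w = g \<and> length w = n" using word_ex[OF assms] by blast
  then have "\<exists>w\<in>lists X. val w = g \<and> length w = N g" unfolding word_norm_def by (rule LeastI_ex)
  then show thesis using that by blast
qed

lemma norm_le: "w \<in> lists X \<Longrightarrow> N (val w) \<le> length w"
  unfolding word_norm_def by (rule Least_le) blast

lemma norm_one [simp]: "N \<one> = 0"
  using norm_le[of "[]"] by simp

lemma norm_0D: "\<lbrakk>g \<in> carrier G; N g = 0\<rbrakk> \<Longrightarrow> g = \<one>"
  using norm_word[of g] by (metis length_0_conv val_Nil)

lemma norm_mult:
  assumes "g \<in> carrier G" "h \<in> carrier G" shows "N (g \<otimes> h) \<le> N g + N h"
proof -
  obtain u where u: "u \<in> lists X" "val u = g" "length u = N g" using norm_word[OF assms(1)] .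
  obtain v where v: "v \<in> lists X" "val v = h" "length v = N h" using norm_word[OF assms(2)] .
  have "u @ v \<in> lists X" "val (u @ v) = g \<otimes> h" using u v by (auto simp: val_append)
  then show ?thesis using norm_le[of "u @ v"] u v by simp
qed

lemma norm_inv_le:
  assumes "g \<in> carrier G" shows "N (inv g) \<le> N g"
proof -
  have "\<exists>v\<in>lists X. val v = inv (val w) \<and> length v = length w" if "w \<in> lists X" for w
    using that
  proof (induction w)
    case Nil
    then show ?case by (intro bexI[of _ "[]"]) auto
  next
    case (Cons x w)
    then obtain v where v: "v \<in> lists X" "val v = inv (val w)" "length v = length w" by auto
    have x: "x \<in> carrier G" "inv x \<in> X" using Cons generators_closed generators_inv by auto
    have "val (v @ [inv x]) = inv (x \<otimes> val w)"
      using v x Cons by (simp add: val_append inv_mult_group)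
    then show ?case using v x by (intro bexI[of _ "v @ [inv x]"]) auto
  qed
  then show ?thesis using norm_word[OF assms] norm_le by metis
qed

lemma norm_inv: "g \<in> carrier G \<Longrightarrow> N (inv g) = N g"
  using norm_inv_le[of g] norm_inv_le[of "inv g"] by simp

lemma norm_geodesic_factor:
  assumes "a \<in> lists X" "v \<in> lists X" "b \<in> lists X" and "N (val (a @ v @ b)) = length (a @ v @ b)"
  shows "N (val v) = length v"
proof -
  have "N (val (a @ v @ b)) \<le> N (val a) + (N (val v) + N (val b))"
    using assms norm_mult[of "val a" "val v \<otimes> val b"] norm_mult[of "val v" "val b"]
    by (simp add: val_append)
  then show ?thesis using assms norm_le[of a] norm_le[of b] norm_le[of v] by simp
qed

lemma norm_geodesic_slice:
  assumes "w \<in> lists X" "N (val w) = length w" "i \<le> j" "j \<le> length w"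
  shows "N (inv (val (take i w)) \<otimes> val (take j w)) = j - i"
proof -
  define a v b where "a = take i w" and "v = drop i (take j w)" and "b = drop j w"
  have tj: "take j w = a @ v"
    using assms append_take_drop_id[of i "take j w"] by (simp add: a_def v_def min_def)
  have w: "w = a @ v @ b" using append_take_drop_id[of j w] unfolding tj b_def by simp
  have l: "a \<in> lists X" "v \<in> lists X" "b \<in> lists X" using assms(1) w by auto
  have "N (val v) = length v" using norm_geodesic_factor[OF l] assms w by simp
  moreover have "inv (val a) \<otimes> val (a @ v) = val v" using l by (simp add: val_append inv_cancel)
  ultimately show ?thesis unfolding tj using assms by (simp add: a_def v_def)
qed

lemma take_lists: "w \<in> lists X \<Longrightarrow> take i w \<in> lists X"
  and drop_lists: "w \<in> lists X \<Longrightarrow> drop i w \<in> lists X"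
  by (auto simp: lists_eq_set dest: in_set_takeD in_set_dropD)

sublocale graph_metric "carrier G" "cayley_dist G X"
proof
  fix x y assume x: "x \<in> carrier G" and y: "y \<in> carrier G"
  show "cayley_dist G X x x = 0" using x by (simp add: cayley_dist_def)
  show "x = y" if "cayley_dist G X x y = 0"
  proof -
    have "inv x \<otimes> y = \<one>" using norm_0D x y that by (simp add: cayley_dist_def)
    then have "x \<otimes> (inv x \<otimes> y) = x" using x by simp
    then show ?thesis using x y by (simp add: cancel_inv)
  qed
  have "inv (inv x \<otimes> y) = inv y \<otimes> x" using x y by (simp add: inv_mult_group)
  then show "cayley_dist G X x y = cayley_dist G X y x"
    unfolding cayley_dist_def using norm_inv[of "inv x \<otimes> y"] x y by simp
  show "cayley_dist G X x z \<le> cayley_dist G X x y + cayley_dist G X y z" if z: "z \<in> carrier G" for z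
  proof -
    have "inv x \<otimes> z = (inv x \<otimes> y) \<otimes> (inv y \<otimes> z)" using x y z by (simp add: group_simps)
    then show ?thesis unfolding cayley_dist_def using norm_mult[of "inv x \<otimes> y" "inv y \<otimes> z"] x y z by simp
  qed
  obtain w where w: "w \<in> lists X" "val w = inv x \<otimes> y" "length w = cayley_dist G X x y"
    using norm_word[of "inv x \<otimes> y"] x y unfolding cayley_dist_def by auto
  define f where "f i = x \<otimes> val (take i w)" for i
  have "f 0 = x" "f (cayley_dist G X x y) = y" "\<forall>i. f i \<in> carrier G"
    using w x y by (auto simp: f_def cancel_inv take_lists)
  moreover have "cayley_dist G X (f i) (f j) = j - i" if "i \<le> j" "j \<le> cayley_dist G X x y" for i j
  proof -
    have "inv (f i) \<otimes> f j = inv (val (take i w)) \<otimes> val (take j w)"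
      using w(1) x by (simp add: f_def group_simps take_lists)
    then show ?thesis unfolding cayley_dist_def[of G X "f i"]
      using norm_geodesic_slice[OF w(1) _ that(1)] that(2) w by (simp add: cayley_dist_def)
  qed
  ultimately show "\<exists>f. f 0 = x \<and> f (cayley_dist G X x y) = y \<and> (\<forall>i. f i \<in> carrier G) \<and>
      (\<forall>i j. i \<le> j \<longrightarrow> j \<le> cayley_dist G X x y \<longrightarrow> cayley_dist G X (f i) (f j) = j - i)"
    by blast
qed

abbreviation D :: "'a \<Rightarrow> 'a \<Rightarrow> nat" where "D \<equiv> cayley_dist G X"

lemma geodesic_list:
  assumes "geodesic f p q"
  shows "cayley_geodesic G X p q (map f [0..<Suc (D p q)])"
proof -
  note f = geodesicD[OF assms]
  have n: "map f [0..<Suc (D p q)] ! i = f i" if "i < Suc (D p q)" for i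
    using that nth_map_upt[of i "Suc (D p q)" 0 f] by simp
  have "hd (map f [0..<Suc (D p q)]) = p" using f(1) hd_conv_nth[of "map f [0..<Suc (D p q)]"] n[of 0] by simp
  moreover have "last (map f [0..<Suc (D p q)]) = q" using f(2) by simp
  ultimately show ?thesis unfolding cayley_geodesic_def using f(3,4) n by (auto simp del: upt_Suc)
qed

text \<open>Every point of an interval lies on some geodesic, which may be taken as the named side
  of a triangle.\<close>

lemma slim_if_cayley_slim:
  assumes "cayley_slim_triangles G X \<delta>"
  shows "slim \<delta>"
  unfolding slim_def
proof (intro ballI)
  fix p q r x
  assume S: "p \<in> carrier G" "q \<in> carrier G" "r \<in> carrier G" and x: "x \<in> interval p q"
  obtain f where f: "geodesic f p q" "f (D p x) = x" using geodesic_through[OF S(1,2) x] .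
  obtain g where g: "geodesic g q r" using geodesic_through[OF S(2,3) left_endpoint[OF S(2,3)]] .
  obtain h where h: "geodesic h p r" using geodesic_through[OF S(1,3) left_endpoint[OF S(1,3)]] .
  have "D p x < Suc (D p q)" using x by (auto simp: interval_def)
  then have "x \<in> set (map f [0..<Suc (D p q)])"
    using f(2) by (metis atLeast0LessThan image_eqI lessThan_iff set_map set_upt)
  then obtain y where y: "y \<in> set (map g [0..<Suc (D q r)]) \<union> set (map h [0..<Suc (D p r)])" "D x y \<le> \<delta>"
    using assms geodesic_list[OF f(1)] geodesic_list[OF g] geodesic_list[OF h]
    unfolding cayley_slim_triangles_def by blast
  have "y \<in> interval q r \<union> interval p r"
    using y(1) geodesic_interval(1)[OF g] geodesic_interval(1)[OF h] by (auto simp del: upt_Suc)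
  then show "\<exists>y\<in>interval p r \<union> interval r q. D x y \<le> \<delta>"
    using y(2) interval_sym[OF S(2,3)] by blast
qed

lemma norm_le_mult:
  assumes "Y \<subseteq> carrier G" "\<And>y. y \<in> Y \<Longrightarrow> N y \<le> M" "w \<in> lists Y"
  shows "N (val w) \<le> M * length w"
  using assms(3)
proof (induction w)
  case (Cons y w)
  have "val w \<in> carrier G" using Cons assms(1) by (intro val_closed_carrier) auto
  then have "N (val (y # w)) \<le> N y + N (val w)" using Cons assms(1) norm_mult[of y] by auto
  then show ?case using Cons assms(2)[of y] by simp
qed simp

lemma slim_change_generators:
  assumes Y: "fin_inv_gen_set G Y" and sl: "cayley_slim_triangles G Y \<delta>"
  shows "\<exists>\<delta>'. slim \<delta>'"
proof -
  interpret Y: word_group G Y by unfold_locales (rule Y)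
  \<comment> \<open>The inserted 0 keeps \<open>Max\<close> meaningful when both generating sets are
    empty, as can happen for the trivial group.\<close>
  define M where "M = Max (insert 0 (N ` Y \<union> word_norm G Y ` X))"
  have fin: "finite (insert 0 (N ` Y \<union> word_norm G Y ` X))"
    using finite_generators Y.finite_generators by simp
  have MY: "N y \<le> M" if "y \<in> Y" for y unfolding M_def using fin that by (intro Max_ge) auto
  have MX: "word_norm G Y x \<le> M" if "x \<in> X" for x unfolding M_def using fin that by (intro Max_ge) auto
  have XY: "word_norm G Y g \<le> M * N g" if "g \<in> carrier G" for g
    using norm_word[OF that] Y.norm_le_mult[OF generators_closed MX] by metis
  have YX: "N g \<le> M * word_norm G Y g" if "g \<in> carrier G" for g
    using Y.norm_word[OF that] norm_le_mult[OF Y.generators_closed MY] by metis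
  interpret bilipschitz_metrics "carrier G" "cayley_dist G Y" D M
    by unfold_locales (auto simp: cayley_dist_def XY YX)
  show ?thesis using slim_transfer Y.slim_if_cayley_slim[OF sl] by blast
qed

lemma finite_ball: "finite {g \<in> carrier G. N g \<le> K}"
proof (rule finite_subset)
  show "{g \<in> carrier G. N g \<le> K} \<subseteq> val ` {w. set w \<subseteq> X \<and> length w \<le> K}"
  proof
    fix g assume g: "g \<in> {g \<in> carrier G. N g \<le> K}"
    then obtain w where "w \<in> lists X" "val w = g" "length w = N g" using norm_word by blast
    then show "g \<in> val ` {w. set w \<subseteq> X \<and> length w \<le> K}" using g by (auto simp: lists_eq_set)
  qed
  show "finite (val ` {w. set w \<subseteq> X \<and> length w \<le> K})"
    using finite_lists_length_le[OF finite_generators] by simp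
qed

lemma geodesic_word_interval:
  assumes w: "w \<in> lists X" "N (val w) = length w" "i \<le> length w" and g: "g \<in> carrier G"
  shows "g \<otimes> val (take i w) \<in> interval g (g \<otimes> val w)" "D g (g \<otimes> val (take i w)) = i"
    "D (g \<otimes> val (take i w)) (g \<otimes> val w) = length w - i"
proof -
  have c: "val (take i w) \<in> carrier G" "val w \<in> carrier G" using w by (auto simp: take_lists)
  have t: "D g (g \<otimes> val (take j w)) = j" if "j \<le> length w" for j
    using norm_geodesic_slice[OF w(1,2), of 0 j] that g w(1)
    by (simp add: cayley_dist_def inv_cancel take_lists)
  show a: "D g (g \<otimes> val (take i w)) = i" using t w by simp
  show b: "D (g \<otimes> val (take i w)) (g \<otimes> val w) = length w - i"
    using norm_geodesic_slice[OF w(1,2) w(3)] g c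
    by (simp add: cayley_dist_def group_simps)
  show "g \<otimes> val (take i w) \<in> interval g (g \<otimes> val w)"
    using a b t[of "length w"] w g c by (simp add: interval_def)
qed

section \<open>Words of minimal length in their conjugacy class\<close>

lemma conj_norm_le_norm:
  assumes "g \<in> carrier G" shows "conj_norm G X g \<le> N g"
proof -
  have "conj_in G g g" unfolding conj_in_def using assms by (intro bexI[of _ \<one>]) auto
  then show ?thesis unfolding conj_norm_def using assms by (intro Least_le) blast
qed

text \<open>Trades the minimum over the conjugacy class for one inequality per conjugator. With
  \<open>inv g\<close> on the left, \<open>g\<close> and \<open>val w \<otimes> g\<close> are the
  corners opposite to the path \<open>w\<close> in the conjugacy quadrilateral.\<close>

lemma ConjGeo_iff:
  assumes w: "w \<in> lists X"
  shows "w \<in> ConjGeo G X \<longleftrightarrow> (\<forall>g\<in>carrier G. length w \<le> N (inv g \<otimes> val w \<otimes> g))"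
proof
  assume "w \<in> ConjGeo G X"
  then have len: "length w = conj_norm G X (val w)" by (simp add: ConjGeo_def)
  show "\<forall>g\<in>carrier G. length w \<le> N (inv g \<otimes> val w \<otimes> g)"
  proof
    fix g assume g: "g \<in> carrier G"
    have "conj_in G (val w) (inv g \<otimes> val w \<otimes> g)"
      unfolding conj_in_def using g w by (intro bexI[of _ "inv g"]) auto
    then show "length w \<le> N (inv g \<otimes> val w \<otimes> g)"
      unfolding len conj_norm_def using g val_closed[OF w]
      by (intro Least_le bexI[of _ "inv g \<otimes> val w \<otimes> g"]) simp_all
  qed
next
  assume H: "\<forall>g\<in>carrier G. length w \<le> N (inv g \<otimes> val w \<otimes> g)"
  have "conj_in G (val w) (val w)" unfolding conj_in_def using w by (intro bexI[of _ \<one>]) auto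
  then have "\<exists>n. \<exists>h\<in>carrier G. conj_in G (val w) h \<and> N h = n"
    using val_closed[OF w] by blast
  then have "\<exists>h\<in>carrier G. conj_in G (val w) h \<and> N h = conj_norm G X (val w)"
    unfolding conj_norm_def by (rule LeastI_ex)
  then obtain x where x: "x \<in> carrier G" "N (x \<otimes> val w \<otimes> inv x) = conj_norm G X (val w)"
    by (auto simp: conj_in_def)
  then have "length w \<le> conj_norm G X (val w)" using H[rule_format, of "inv x"] by simp
  moreover have "conj_norm G X (val w) \<le> length w"
    using conj_norm_le_norm norm_le[OF w] w by (meson le_trans val_closed)
  ultimately show "w \<in> ConjGeo G X" using w by (simp add: ConjGeo_def)
qed

section \<open>Shortcuts and tracking by shorter conjugates\<close>

text \<open>The cyclic word \<open>u v\<close> has two junctions, displaced by \<beta> and \<gamma>;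
  conjugation makes the displacement at the beginning and at the end the same \<gamma>. The word
  \<open>u\<close> enters only through norms and its length, which later leaves finitely many
  classes.\<close>

definition shortcut :: "nat \<Rightarrow> 'a list \<Rightarrow> 'a list \<Rightarrow> bool" where
  "shortcut K u v \<longleftrightarrow> (\<exists>\<beta>\<in>carrier G. \<exists>\<gamma>\<in>carrier G. N \<beta> \<le> K \<and> N \<gamma> \<le> K \<and>
     N (inv \<gamma> \<otimes> val u \<otimes> \<beta>) + N (inv \<beta> \<otimes> val v \<otimes> \<gamma>) < length u + length v)"

lemma shortcut_sym: "shortcut K u v \<longleftrightarrow> shortcut K v u"
  unfolding shortcut_def by (metis add.commute)

lemma shortcut_mono: "shortcut K u v \<Longrightarrow> K \<le> K' \<Longrightarrow> shortcut K' u v"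
  unfolding shortcut_def by (meson le_trans)

text \<open>The two new sides multiply to the conjugate of \<open>val (u @ v)\<close> by \<gamma>,
  which is therefore too short.\<close>

lemma shortcut_not_ConjGeo:
  assumes u: "u \<in> lists X" and v: "v \<in> lists X" and s: "shortcut K u v"
  shows "u @ v \<notin> ConjGeo G X"
proof
  assume cg: "u @ v \<in> ConjGeo G X"
  obtain \<beta> \<gamma> where b: "\<beta> \<in> carrier G" "\<gamma> \<in> carrier G"
    and l: "N (inv \<gamma> \<otimes> val u \<otimes> \<beta>) + N (inv \<beta> \<otimes> val v \<otimes> \<gamma>) < length u + length v"
    using s unfolding shortcut_def by blast
  have "inv \<gamma> \<otimes> val (u @ v) \<otimes> \<gamma> = (inv \<gamma> \<otimes> val u \<otimes> \<beta>) \<otimes> (inv \<beta> \<otimes> val v \<otimes> \<gamma>)"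
    using b u v by (simp add: val_append group_simps)
  then have "N (inv \<gamma> \<otimes> val (u @ v) \<otimes> \<gamma>) \<le> N (inv \<gamma> \<otimes> val u \<otimes> \<beta>) + N (inv \<beta> \<otimes> val v \<otimes> \<gamma>)"
    using norm_mult b u v by simp
  moreover have "u @ v \<in> lists X" using u v by simp
  ultimately show False using cg b l ConjGeo_iff[of "u @ v"] by fastforce
qed

text \<open>The word \<open>\<zeta>\<close> represents the conjugate by \<open>\<alpha>\<close>; monotonicity of the time change \<open>f\<close> is what allows
  the two cut points on \<open>w\<close> to be moved to \<open>\<zeta>\<close> without increasing the total length.\<close>

definition tracked :: "nat \<Rightarrow> 'a list \<Rightarrow> bool" where
  "tracked K w \<longleftrightarrow> (\<exists>\<alpha>\<in>carrier G. \<exists>\<zeta>\<in>lists X. \<exists>f. mono f \<and> length \<zeta> < length w \<and>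
     val w \<otimes> \<alpha> = \<alpha> \<otimes> val \<zeta> \<and>
     (\<forall>i\<le>length w. D (val (take i w)) (\<alpha> \<otimes> val (take (f i) \<zeta>)) \<le> K))"

lemma tracked_mono: "tracked K w \<Longrightarrow> K \<le> K' \<Longrightarrow> tracked K' w"
  unfolding tracked_def by (meson le_trans)

lemma dist_take_le:
  assumes \<zeta>: "\<zeta> \<in> lists X" and \<alpha>: "\<alpha> \<in> carrier G" and "i \<le> j"
  shows "D (\<alpha> \<otimes> val (take i \<zeta>)) (\<alpha> \<otimes> val (take j \<zeta>)) \<le> length (take j \<zeta>) - length (take i \<zeta>)"
proof -
  have t: "take j \<zeta> = take i \<zeta> @ drop i (take j \<zeta>)"
    using append_take_drop_id[of i "take j \<zeta>"] assms(3) by (simp add: min_def)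
  have l: "take i \<zeta> \<in> lists X" "drop i (take j \<zeta>) \<in> lists X"
    using \<zeta> take_lists drop_lists by blast+
  have "val (take j \<zeta>) = val (take i \<zeta>) \<otimes> val (drop i (take j \<zeta>))"
    using t val_append[OF l] by metis
  then have "inv (\<alpha> \<otimes> val (take i \<zeta>)) \<otimes> (\<alpha> \<otimes> val (take j \<zeta>)) = val (drop i (take j \<zeta>))"
    using l \<alpha> by (simp add: group_simps)
  then show ?thesis unfolding cayley_dist_def using norm_le[OF l(2)] by (simp add: min_def split: if_splits)
qed

text \<open>\<open>a\<close> and \<open>b\<close> are the points on the shorter path opposite the
  junctions \<open>A\<close> and \<open>B\<close>. The part from \<open>a\<close> to
  \<open>b\<close> replaces \<open>v\<close>; the part from \<open>b\<close> to the end of \<zeta>,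
  continued periodically up to the translate of \<open>a\<close>, replaces
  \<open>u1 @ u2\<close>.\<close>

lemma shortcut_if_tracked_aux:
  assumes l: "u1 \<in> lists X" "u2 \<in> lists X" "v \<in> lists X" and tr: "tracked K (u2 @ v @ u1)"
  shows "shortcut K (u1 @ u2) v"
proof -
  define w where "w = u2 @ v @ u1"
  define A B where "A = val u2" and "B = val (u2 @ v)"
  obtain \<alpha> \<zeta> f where \<alpha>: "\<alpha> \<in> carrier G" and \<zeta>: "\<zeta> \<in> lists X" "length \<zeta> < length w"
      "val w \<otimes> \<alpha> = \<alpha> \<otimes> val \<zeta>" and f: "mono f"
    and near: "\<And>i. i \<le> length w \<Longrightarrow> D (val (take i w)) (\<alpha> \<otimes> val (take (f i) \<zeta>)) \<le> K"
    using tr unfolding tracked_def w_def by blast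
  define i j where "i = f (length u2)" and "j = f (length (u2 @ v))"
  have ij: "i \<le> j" using f by (auto simp: i_def j_def intro: monoD)
  define a b where "a = \<alpha> \<otimes> val (take i \<zeta>)" and "b = \<alpha> \<otimes> val (take j \<zeta>)"
  have c: "A \<in> carrier G" "B \<in> carrier G" "a \<in> carrier G" "b \<in> carrier G"
    using l \<zeta> \<alpha> by (auto simp: A_def B_def a_def b_def take_lists)
  have na: "D A a \<le> K" using near[of "length u2"] by (simp add: w_def A_def a_def i_def)
  have nb: "D B b \<le> K" using near[of "length (u2 @ v)"] by (simp add: w_def B_def b_def j_def)
  have d1: "D \<alpha> a \<le> length (take i \<zeta>)"
    using dist_take_le[OF \<zeta>(1) \<alpha>, of 0 i] \<alpha> by (simp add: a_def)
  have d2: "D a b \<le> length (take j \<zeta>) - length (take i \<zeta>)"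
    using dist_take_le[OF \<zeta>(1) \<alpha> ij] by (simp add: a_def b_def)
  \<comment> \<open>The \<open>max\<close> makes the second prefix all of \<zeta> and keeps the
    indices ordered even if \<open>j\<close> exceeds its length.\<close>
  have d3: "D b (val w \<otimes> \<alpha>) \<le> length \<zeta> - length (take j \<zeta>)"
    using dist_take_le[OF \<zeta>(1) \<alpha>, of j "max j (length \<zeta>)"] \<zeta>(3) by (simp add: b_def)
  have "length (take i \<zeta>) \<le> length (take j \<zeta>)" "length (take j \<zeta>) \<le> length \<zeta>" using ij by auto
  then have sum: "D \<alpha> a + D a b + D b (val w \<otimes> \<alpha>) < length w" using d1 d2 d3 \<zeta>(2) by linarith
  have e1: "inv (inv A \<otimes> a) \<otimes> val v \<otimes> (inv B \<otimes> b) = inv a \<otimes> b"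
    using c l by (simp add: A_def B_def val_append group_simps)
  have "inv (inv B \<otimes> b) \<otimes> val (u1 @ u2) \<otimes> (inv A \<otimes> a)
      = (inv b \<otimes> (val w \<otimes> \<alpha>)) \<otimes> (inv \<alpha> \<otimes> a)"
    using c l \<alpha> by (simp add: A_def B_def w_def val_append group_simps)
  then have e2: "N (inv (inv B \<otimes> b) \<otimes> val (u1 @ u2) \<otimes> (inv A \<otimes> a)) \<le> D b (val w \<otimes> \<alpha>) + D \<alpha> a"
    unfolding cayley_dist_def using norm_mult[of "inv b \<otimes> (val w \<otimes> \<alpha>)" "inv \<alpha> \<otimes> a"] c l \<alpha>
    by (simp add: w_def)
  have "N (inv (inv B \<otimes> b) \<otimes> val (u1 @ u2) \<otimes> (inv A \<otimes> a)) +
      N (inv (inv A \<otimes> a) \<otimes> val v \<otimes> (inv B \<otimes> b)) < length (u1 @ u2) + length v"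
    unfolding e1 using e2 sum by (simp add: cayley_dist_def w_def)
  then show ?thesis unfolding shortcut_def using na nb c
    by (intro bexI[of _ "inv A \<otimes> a"] bexI[of _ "inv B \<otimes> b"]) (auto simp: cayley_dist_def)
qed

lemma shortcut_if_tracked:
  assumes l: "u \<in> lists X" "v \<in> lists X" and tr: "tracked K (rotate n (u @ v))"
  shows "shortcut K u v"
proof -
  obtain x y where xy: "u @ v = x @ y" "rotate n (u @ v) = y @ x"
    using rotate_drop_take append_take_drop_id by metis
  then consider (1) z where "u = x @ z" "y = z @ v" | (2) z where "x = u @ z" "v = z @ y"
    by (auto simp: append_eq_append_conv2)
  then show ?thesis
  proof cases
    case 1
    then show ?thesis using shortcut_if_tracked_aux[of x z v K] l tr xy by simp
  next
    case 2
    then have "shortcut K (z @ y) u" using shortcut_if_tracked_aux[of z y u K] l tr xy by simp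
    then show ?thesis using 2 shortcut_sym by simp
  qed
qed

lemma dist_one: "g \<in> carrier G \<Longrightarrow> D \<one> g = N g"
  by (simp add: cayley_dist_def)

lemma geodesic_words_fellow_travel:
  assumes sl: "slim \<delta>" and w: "w \<in> lists X" "N (val w) = length w"
    and z: "z \<in> lists X" "N (val z) = length z"
    and g: "g \<in> carrier G" "N g \<le> K" and D: "D (val w) (g \<otimes> val z) \<le> K" and i: "i \<le> length w"
  shows "D (val (take i w)) (g \<otimes> val (take (min i (length z)) z)) \<le> 6 * \<delta> + 3 * K"
proof (rule slim_fellow_travel[OF sl one_closed val_closed[OF w(1)] g(1) _ _ D])
  show "g \<otimes> val z \<in> carrier G" using g z by simp
  show "D \<one> g \<le> K" using g by (simp add: dist_one)
  have c: "val (take i w) \<in> carrier G" "val w \<in> carrier G" using w(1) take_lists by simp_all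
  show "val (take i w) \<in> interval \<one> (val w)"
    using geodesic_word_interval(1)[OF w i one_closed] c by simp
  show "g \<otimes> val (take (min i (length z)) z) \<in> interval g (g \<otimes> val z)"
    using geodesic_word_interval(1)[OF z _ g(1)] by simp
  have "D \<one> (val (take i w)) = i"
    using geodesic_word_interval(2)[OF w i one_closed] c by simp
  moreover have "D g (g \<otimes> val (take (min i (length z)) z)) = min i (length z)"
    using geodesic_word_interval(2)[OF z _ g(1)] by simp
  moreover have "D g (g \<otimes> val z) = length z" using z g(1) by (simp add: cayley_dist_def inv_cancel)
  ultimately show "D g (g \<otimes> val (take (min i (length z)) z)) = min (D \<one> (val (take i w))) (D g (g \<otimes> val z))"
    by simp
qed

text \<open>The first non-geodesic prefix is one letter longer than a geodesic one, so a geodesic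
  word for its value ends within distance 1 of the latter and fellow travels with constant 1 for the
  ends. The rest of the word is kept, and \<alpha> is the identity.\<close>

lemma tracked_if_not_geodesic:
  assumes sl: "slim \<delta>" and w: "w \<in> lists X" and ng: "N (val w) < length w"
  shows "tracked (6 * \<delta> + 3) w"
proof -
  define i where "i = (LEAST i. i \<le> length w \<and> N (val (take i w)) < i)"
  have i: "i \<le> length w" "N (val (take i w)) < i"
    unfolding i_def using LeastI[of "\<lambda>i. i \<le> length w \<and> N (val (take i w)) < i" "length w"] ng by auto
  obtain k where k: "i = Suc k" using i by (cases i) auto
  have "\<not> N (val (take k w)) < k"
    using not_less_Least[of k "\<lambda>i. i \<le> length w \<and> N (val (take i w)) < i"] i(1) k unfolding i_def by auto
  define t0 where "t0 = take k w"
  have t0: "t0 \<in> lists X" "length t0 = k" using w i(1) k by (auto simp: t0_def take_lists)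
  have geo: "N (val t0) = length t0"
    using \<open>\<not> N (val (take k w)) < k\<close> norm_le[OF t0(1)] t0(2) by (simp add: t0_def)
  have ti: "take i w \<in> lists X" using w by (rule take_lists)
  then obtain z where z: "z \<in> lists X" "val z = val (take i w)" "length z = N (val (take i w))"
    using norm_word[of "val (take i w)"] by auto
  have lz: "length z < i" using z i by simp
  define \<zeta> where "\<zeta> = z @ drop i w"
  define c where "c = i - length z"
  \<comment> \<open>Along the replaced prefix wait at the end of \<open>z\<close>; afterwards shift
    by the number \<open>c\<close> of letters saved. The maximum of the two formulas is monotone and
    switches at \<open>i\<close>.\<close>
  define f where "f j = max (min j (length z)) (j - c)" for j
  have di: "drop i w \<in> lists X" using w by (rule drop_lists)
  have "val w = val (take i w @ drop i w)" by simp
  then have v\<zeta>: "val w = val \<zeta>" unfolding \<zeta>_def using ti di z by (simp add: val_append del: append_take_drop_id)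
  have near: "D (val (take j w)) (\<one> \<otimes> val (take (f j) \<zeta>)) \<le> 6 * \<delta> + 3" if j: "j \<le> length w" for j
  proof (cases "j < i")
    case True
    then have "j \<le> k" "f j = min j (length z)" using k lz by (auto simp: f_def c_def)
    then have tf: "take (f j) \<zeta> = take (min j (length z)) z" "take j w = take j t0"
      by (auto simp: \<zeta>_def t0_def min_def)
    have "D (val t0) (val (take i w)) \<le> 1"
      using dist_take_le[OF w one_closed, of k i] w k by (simp add: t0_def take_lists min_def split: if_splits)
    then have "D (val t0) (\<one> \<otimes> val z) \<le> 1" using z by (metis l_one val_closed)
    then have "D (val (take j t0)) (\<one> \<otimes> val (take (min j (length z)) z)) \<le> 6 * \<delta> + 3 * 1"
      using z t0 \<open>j \<le> k\<close> by (intro geodesic_words_fellow_travel[OF sl t0(1) geo]) simp_all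
    then show ?thesis using tf by simp
  next
    case False
    then have "f j = j - c" "length z \<le> j - c" "j - c - length z = j - i" using lz by (auto simp: f_def c_def)
    then have "take (f j) \<zeta> = z @ take (j - i) (drop i w)" by (simp add: \<zeta>_def)
    moreover have "take j w = take i w @ take (j - i) (drop i w)"
      using False by (metis le_add_diff_inverse not_less take_add)
    ultimately have "val (take (f j) \<zeta>) = val (take j w)"
      using ti z di by (simp add: val_append take_lists)
    then show ?thesis using w by (simp add: take_lists dist_self)
  qed
  have "mono f" by (rule monoI) (auto simp: f_def)
  moreover have "\<zeta> \<in> lists X" using z di by (simp add: \<zeta>_def)
  moreover have "length \<zeta> < length w" using lz i by (simp add: \<zeta>_def)
  ultimately show ?thesis unfolding tracked_def using near v\<zeta> w
    by (intro bexI[of _ \<one>] bexI[of _ \<zeta>] exI[of _ f]) auto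
qed

text \<open>A geodesic word for the conjugate, read from \<open>g\<close>, ends at
  \<open>val w \<otimes> g\<close>; both its ends are within \<open>K\<close> of those of
  \<open>w\<close>.\<close>

lemma tracked_if_short_conjugator:
  assumes sl: "slim \<delta>" and w: "w \<in> lists X" and geo: "N (val w) = length w"
    and g: "g \<in> carrier G" "N g \<le> K" and short: "N (inv g \<otimes> val w \<otimes> g) < length w"
  shows "tracked (6 * \<delta> + 3 * K) w"
proof -
  have W: "val w \<in> carrier G" using w by simp
  obtain z where z: "z \<in> lists X" "val z = inv g \<otimes> val w \<otimes> g" "length z = N (inv g \<otimes> val w \<otimes> g)"
    using norm_word[of "inv g \<otimes> val w \<otimes> g"] w g by auto
  have conj: "val w \<otimes> g = g \<otimes> val z" using z w g by (simp add: group_simps)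
  have Dw: "D (val w) (g \<otimes> val z) \<le> K"
    unfolding conj[symmetric] using W g by (simp add: cayley_dist_def group_simps)
  have near: "D (val (take i w)) (g \<otimes> val (take (min i (length z)) z)) \<le> 6 * \<delta> + 3 * K"
    if "i \<le> length w" for i
    using geodesic_words_fellow_travel[OF sl w geo z(1) _ g Dw that] z by simp
  have "mono (\<lambda>i. min i (length z))" by (rule monoI) auto
  moreover have "length z < length w" using z short by simp
  ultimately show ?thesis unfolding tracked_def using near z(1) conj g(1)
    by (intro bexI[of _ g] bexI[of _ z] exI[of _ "\<lambda>i. min i (length z)"]) auto
qed


text \<open>Take \<open>g\<close> of minimal norm \<open>L\<close> over all rotations. Then every vertex of the path \<open>W\<close> is at distance
  at least \<open>L\<close> from the opposite side of the quadrilateral, since a connecting element again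
  conjugates a rotation to something short. If \<open>L\<close> were large, the midpoint of \<open>W\<close> would be far from
  all other sides.\<close>

lemma ex_short_conjugator:
  assumes sl: "slim \<delta>" and w: "w \<in> lists X" and long: "8 * \<delta> + 2 \<le> length w"
    and geo: "\<And>n. N (val (rotate n w)) = length w" and nc: "w \<notin> ConjGeo G X"
  shows "\<exists>n. \<exists>g\<in>carrier G. N g \<le> 2 * \<delta> \<and> N (inv g \<otimes> val (rotate n w) \<otimes> g) < length w"
proof -
  define P where "P l \<longleftrightarrow> (\<exists>n. \<exists>g\<in>carrier G. N g = l \<and> N (inv g \<otimes> val (rotate n w) \<otimes> g) < length w)" for l
  obtain g where g0: "g \<in> carrier G" "\<not> length w \<le> N (inv g \<otimes> val w \<otimes> g)"
    using nc ConjGeo_iff[OF w] by blast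
  then have "N (inv g \<otimes> val (rotate 0 w) \<otimes> g) < length w" by simp
  with g0(1) have "P (N g)" unfolding P_def by blast
  define L where "L = (LEAST l. P l)"
  have "P L" unfolding L_def using \<open>P (N g)\<close> by (rule LeastI)
  then obtain n g where g: "g \<in> carrier G" "N g = L"
    and short: "N (inv g \<otimes> val (rotate n w) \<otimes> g) < length w" unfolding P_def by blast
  define W where "W = rotate n w"
  have Wl: "W \<in> lists X" "length W = length w" using w by (auto simp: W_def lists_eq_set)
  define i where "i = length w div 2"
  define x where "x = val (take i W)"
  \<comment> \<open>The length bound puts the midpoint farther than \<open>4 * \<delta>\<close> from
    both ends, which will exclude the short sides.\<close>
  have i: "i < length w" "4 * \<delta> + 1 \<le> i" "4 * \<delta> + 1 \<le> length w - i" using long by (auto simp: i_def)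
  have tl: "take i W \<in> lists X" "drop i W \<in> lists X" using Wl take_lists drop_lists by blast+
  have V: "val W \<in> carrier G" "x \<in> carrier G" using Wl tl by (simp_all add: x_def)
  have valW: "val W = x \<otimes> val (drop i W)" using val_append[OF tl] by (simp add: x_def)
  have Wg: "val W \<otimes> g \<in> carrier G" using V g by simp
  \<comment> \<open>\<open>inv x \<otimes> y\<close> conjugates the rotation starting at
    \<open>x\<close> to the product of the two parts of the opposite side in swapped order. Their
    lengths add up to less than \<open>length w\<close>, so minimality of \<open>L\<close>
    applies.\<close>
  have far: "L \<le> D x y" if y: "y \<in> interval g (val W \<otimes> g)" for y
  proof -
    have yc: "y \<in> carrier G" "D g y + D y (val W \<otimes> g) = D g (val W \<otimes> g)"
      using y by (auto simp: interval_def)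
    have "rotate i W = drop i W @ take i W" using rotate_drop_take[of i W] i Wl by simp
    then have "rotate (i + n) w = drop i W @ take i W" by (simp add: W_def rotate_rotate)
    then have r: "val (rotate (i + n) w) = val (drop i W) \<otimes> x" using val_append[OF tl(2,1)] by (simp add: x_def)
    have h: "inv x \<otimes> y \<in> carrier G" using V yc by simp
    have "inv (inv x \<otimes> y) \<otimes> val (rotate (i + n) w) \<otimes> (inv x \<otimes> y) = (inv y \<otimes> (val W \<otimes> g)) \<otimes> (inv g \<otimes> y)"
      unfolding r valW using V yc g tl by (simp add: group_simps)
    then have "N (inv (inv x \<otimes> y) \<otimes> val (rotate (i + n) w) \<otimes> (inv x \<otimes> y)) \<le> D y (val W \<otimes> g) + D g y"
      unfolding cayley_dist_def using norm_mult[of "inv y \<otimes> (val W \<otimes> g)" "inv g \<otimes> y"] V yc g by simp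
    also have "\<dots> = N (inv g \<otimes> val W \<otimes> g)"
      using yc(2) V g by (simp add: cayley_dist_def m_assoc)
    also have "\<dots> < length w" using short by (simp add: W_def)
    finally have "P (N (inv x \<otimes> y))" unfolding P_def using h by blast
    then show ?thesis unfolding L_def cayley_dist_def by (rule Least_le)
  qed
  have W0: "N (val W) = length W" using geo Wl by (simp add: W_def)
  have il: "i \<le> length W" using i Wl by simp
  have x: "x \<in> interval \<one> (val W)" "D \<one> x = i" "D x (val W) = length w - i"
    using geodesic_word_interval[OF Wl(1) W0 il one_closed] V Wl by (simp_all add: x_def)
  obtain y where y: "y \<in> interval \<one> g \<or> y \<in> interval g (val W \<otimes> g) \<or> y \<in> interval (val W \<otimes> g) (val W)"
    "y \<in> carrier G" "D x y \<le> 2 * \<delta>"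
    using slim_quadrilateral[OF sl one_closed V(1) g(1) Wg x(1)] by metis
  have yx: "D y x = D x y" by (rule dist_sym[OF y(2) V(2)])
  have "L \<le> 2 * \<delta>"
    using y(1)
  proof (elim disjE)
    \<comment> \<open>Since \<open>g\<close> is at least \<open>L\<close> away from
      \<open>x\<close>, \<open>y\<close> would be within \<open>2 * \<delta>\<close> of the corner
      \<open>\<one>\<close>, so \<open>i \<le> 4 * \<delta>\<close>, a contradiction. The other
      short side is symmetric.\<close>
    assume "y \<in> interval \<one> g"
    then have "D \<one> y + D y g = D \<one> g" by (simp add: interval_def)
    then have "D \<one> y + D y g = L" using g dist_one[OF g(1)] by simp
    moreover have "L \<le> D x y + D y g"
      using far[OF left_endpoint[OF g(1) Wg]] triangle[OF V(2) y(2) g(1)] by simp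
    moreover have "i \<le> D \<one> y + D y x" using triangle[OF one_closed y(2) V(2)] x(2) by simp
    ultimately show ?thesis using yx y(3) i by linarith
  next
    assume "y \<in> interval g (val W \<otimes> g)"
    then show ?thesis using far y(3) by force
  next
    assume "y \<in> interval (val W \<otimes> g) (val W)"
    then have "D (val W \<otimes> g) y + D y (val W) = D (val W \<otimes> g) (val W)" by (simp add: interval_def)
    also have "\<dots> = D (val W) (val W \<otimes> g)" by (rule dist_sym[OF Wg V(1)])
    also have "\<dots> = L" using g V by (simp add: cayley_dist_def inv_cancel)
    finally have "D (val W \<otimes> g) y + D y (val W) = L" .
    moreover have "L \<le> D x y + D y (val W \<otimes> g)"
      using far[OF right_endpoint[OF g(1) Wg]] triangle[OF V(2) y(2) Wg] by simp
    moreover have "D y (val W \<otimes> g) = D (val W \<otimes> g) y" by (rule dist_sym[OF y(2) Wg])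
    moreover have "length w - i \<le> D x y + D y (val W)" using triangle[OF V(2) y(2) V(1)] x(3) by simp
    ultimately show ?thesis using y(3) i by linarith
  qed
  then show ?thesis using g short by blast
qed

text \<open>Choose \<beta> so that the first side is trivial and the second is the whole conjugate.
  The bound is not uniform; this is meant for the finitely many short words.\<close>

lemma ex_shortcut_if_not_ConjGeo:
  assumes u: "u \<in> lists X" and v: "v \<in> lists X" and nc: "u @ v \<notin> ConjGeo G X"
  shows "\<exists>K. shortcut K u v"
proof -
  have uv: "u @ v \<in> lists X" using u v by simp
  obtain g where g: "g \<in> carrier G" "N (inv g \<otimes> val (u @ v) \<otimes> g) < length (u @ v)"
    using nc ConjGeo_iff[OF uv] by (auto simp: not_le)
  define \<beta> where "\<beta> = inv (val u) \<otimes> g"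
  have b: "\<beta> \<in> carrier G" "val u \<in> carrier G" "val v \<in> carrier G" using u v g by (simp_all add: \<beta>_def)
  have "inv g \<otimes> val u \<otimes> \<beta> = \<one>" using g b by (simp add: \<beta>_def group_simps)
  moreover have "inv \<beta> \<otimes> val v \<otimes> g = inv g \<otimes> val (u @ v) \<otimes> g"
    using g b u v by (simp add: \<beta>_def val_append group_simps)
  ultimately have "shortcut (max (N \<beta>) (N g)) u v"
    unfolding shortcut_def using g b by (intro bexI[of _ \<beta>] bexI[of _ g]) simp_all
  then show ?thesis by blast
qed

lemma shortcut_criterion:
  assumes sl: "slim \<delta>"
  shows "\<exists>K. \<forall>u\<in>lists X. \<forall>v\<in>lists X. u @ v \<in> ConjGeo G X \<longleftrightarrow> \<not> shortcut K u v"
proof -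
  define Sm where "Sm = {p. set (fst p) \<subseteq> X \<and> length (fst p) \<le> 8 * \<delta> + 2 \<and> set (snd p) \<subseteq> X \<and> length (snd p) \<le> 8 * \<delta> + 2}"
  have "Sm = {u. set u \<subseteq> X \<and> length u \<le> 8 * \<delta> + 2} \<times> {u. set u \<subseteq> X \<and> length u \<le> 8 * \<delta> + 2}"
    by (auto simp: Sm_def)
  then have fin: "finite Sm" using finite_lists_length_le[OF finite_generators, of "8 * \<delta> + 2"] by simp
  \<comment> \<open>Short words are handled one by one. For pairs whose product lies in
    \<open>ConjGeo\<close> the value is arbitrary but harmless, as only a finite maximum is
    taken.\<close>
  define k where "k p = (LEAST K. shortcut K (fst p) (snd p))" for p
  \<comment> \<open>\<open>12 * \<delta> + 3\<close> covers both \<open>6 * \<delta> + 3\<close> for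
    a non-geodesic rotation and \<open>6 * \<delta> + 3 * (2 * \<delta>)\<close> for a short
    conjugator.\<close>
  define K where "K = Max (insert (12 * \<delta> + 3) (k ` Sm))"
  have K: "12 * \<delta> + 3 \<le> K" "\<And>p. p \<in> Sm \<Longrightarrow> k p \<le> K" using fin by (auto simp: K_def)
  have "shortcut K u v" if u: "u \<in> lists X" and v: "v \<in> lists X" and nc: "u @ v \<notin> ConjGeo G X" for u v
  proof (cases "length (u @ v) < 8 * \<delta> + 2")
    case True
    then have "(u, v) \<in> Sm" using u v by (auto simp: Sm_def lists_eq_set)
    moreover have "shortcut (k (u, v)) u v"
      unfolding k_def using ex_shortcut_if_not_ConjGeo[OF u v nc] LeastI_ex by simp
    ultimately show ?thesis using K(2) shortcut_mono by blast
  next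
    case False
    have uv: "u @ v \<in> lists X" using u v by simp
    have rl: "rotate n (u @ v) \<in> lists X" for n using uv by (auto simp: lists_eq_set)
    have "\<exists>n. tracked (12 * \<delta> + 3) (rotate n (u @ v))"
    proof (cases "\<exists>n. N (val (rotate n (u @ v))) < length (u @ v)")
      case True
      then obtain n where "tracked (6 * \<delta> + 3) (rotate n (u @ v))"
        using tracked_if_not_geodesic[OF sl rl] by auto
      then have "tracked (12 * \<delta> + 3) (rotate n (u @ v))" by (rule tracked_mono) simp
      then show ?thesis by blast
    next
      case geo: False
      have geo: "N (val (rotate n (u @ v))) = length (u @ v)" for n
        using geo norm_le[OF rl[of n]] by (metis le_neq_implies_less length_rotate)
      obtain n g where g: "g \<in> carrier G" "N g \<le> 2 * \<delta>" "N (inv g \<otimes> val (rotate n (u @ v)) \<otimes> g) < length (u @ v)"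
        using ex_short_conjugator[OF sl uv _ geo nc] False by auto
      have "tracked (6 * \<delta> + 3 * (2 * \<delta>)) (rotate n (u @ v))"
        using tracked_if_short_conjugator[OF sl rl _ g(1,2)] geo g(3) by simp
      then have "tracked (12 * \<delta> + 3) (rotate n (u @ v))" by (rule tracked_mono) simp
      then show ?thesis by blast
    qed
    then show ?thesis using shortcut_if_tracked[OF u v] shortcut_mono K(1) by blast
  qed
  then show ?thesis using shortcut_not_ConjGeo by blast
qed

end

section \<open>Finite-index criterion and the shortlex order\<close>

text \<open>The Myhill-Nerode construction. The left quotients of \<open>L\<close>, coded as natural
  numbers, serve as states rather than the values of \<phi>, since \<phi> may fail to determine its
  value after a further letter.\<close>

lemma regular_language_if_finite_index:
  fixes \<phi> :: "'c list \<Rightarrow> 'd"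
  assumes L: "L \<subseteq> lists A" and fin: "finite (\<phi> ` lists A)"
    and cong: "\<And>u u' v. \<lbrakk>u \<in> lists A; u' \<in> lists A; v \<in> lists A; \<phi> u = \<phi> u'; u @ v \<in> L\<rbrakk> \<Longrightarrow> u' @ v \<in> L"
  shows "regular_language A L"
proof -
  define R where "R u = {v \<in> lists A. u @ v \<in> L}" for u
  define \<R> where "\<R> = R ` lists A"
  have Req: "R u = R u'" if "u \<in> lists A" "u' \<in> lists A" "\<phi> u = \<phi> u'" for u u'
    unfolding R_def using cong[OF that(1,2) _ that(3)] cong[OF that(2,1) _ that(3)[symmetric]] by blast
  \<comment> \<open>Words with the same value of \<phi> have the same quotient, so one
    representative per value exhausts all quotients.\<close>
  have "\<R> \<subseteq> (\<lambda>c. R (SOME u. u \<in> lists A \<and> \<phi> u = c)) ` (\<phi> ` lists A)"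
  proof
    fix S assume "S \<in> \<R>"
    then obtain u where u: "u \<in> lists A" "S = R u" by (auto simp: \<R>_def)
    define u' where "u' = (SOME u'. u' \<in> lists A \<and> \<phi> u' = \<phi> u)"
    have "\<exists>u'. u' \<in> lists A \<and> \<phi> u' = \<phi> u" using u by blast
    then have "u' \<in> lists A \<and> \<phi> u' = \<phi> u" unfolding u'_def by (rule someI_ex)
    then have "S = R u'" using Req[of u' u] u by simp
    then show "S \<in> (\<lambda>c. R (SOME u. u \<in> lists A \<and> \<phi> u = c)) ` (\<phi> ` lists A)"
      using u unfolding u'_def by blast
  qed
  then have "finite \<R>" using fin finite_surj by blast
  then obtain h :: "'c list set \<Rightarrow> nat" where h: "inj_on h \<R>"
    using finite_imp_inj_to_nat_seg by blast
  \<comment> \<open>A code is turned back into its quotient, which is then divided by the letter;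
    numbers coding no quotient give junk that a run never meets.\<close>
  define step where "step q x = h {v \<in> lists A. x # v \<in> inv_into \<R> h q}" for q x
  have inv: "inv_into \<R> h (h (R u)) = R u" if "u \<in> lists A" for u
    using inv_into_f_f[OF h] that by (simp add: \<R>_def)
  have stepR: "step (h (R u)) x = h (R (u @ [x]))" if "u \<in> lists A" "x \<in> A" for u x
  proof -
    have "{v \<in> lists A. x # v \<in> R u} = R (u @ [x])" using that by (auto simp: R_def)
    then show ?thesis by (simp add: step_def inv[OF that(1)])
  qed
  have run: "foldl step (h (R [])) w = h (R w)" if "w \<in> lists A" for w
    using that by (induction w rule: rev_induct) (auto simp: stepR)
  have acc: "h (R w) \<in> h ` {S \<in> \<R>. [] \<in> S} \<longleftrightarrow> w \<in> L" if "w \<in> lists A" for w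
  proof -
    have "R w \<in> \<R>" using that by (simp add: \<R>_def)
    then have "h (R w) \<in> h ` {S \<in> \<R>. [] \<in> S} \<longleftrightarrow> R w \<in> {S \<in> \<R>. [] \<in> S}"
      using inj_on_image_mem_iff[OF h, of "R w" "{S \<in> \<R>. [] \<in> S}"] by blast
    then show ?thesis using \<open>R w \<in> \<R>\<close> by (simp add: R_def)
  qed
  have acc': "foldl step (h (R [])) w \<in> h ` {S \<in> \<R>. [] \<in> S} \<longleftrightarrow> w \<in> L" if "w \<in> lists A" for w
    unfolding run[OF that] by (rule acc[OF that])
  show ?thesis
    unfolding regular_language_def
  proof (intro exI conjI)
    show "finite (h ` \<R>)" using \<open>finite \<R>\<close> by simp
    show "h (R []) \<in> h ` \<R>" by (auto simp: \<R>_def)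
    show "h ` {S \<in> \<R>. [] \<in> S} \<subseteq> h ` \<R>" by auto
    show "\<forall>q\<in>h ` \<R>. \<forall>x\<in>A. step q x \<in> h ` \<R>"
    proof (intro ballI)
      fix q x assume "q \<in> h ` \<R>" "x \<in> A"
      then obtain u where "u \<in> lists A" "q = h (R u)" by (auto simp: \<R>_def)
      then show "step q x \<in> h ` \<R>" using stepR \<open>x \<in> A\<close> by (auto simp: \<R>_def)
    qed
    show "L = {w \<in> lists A. foldl step (h (R [])) w \<in> h ` {S \<in> \<R>. [] \<in> S}}"
      using L acc' by blast
  qed
qed

lemma lenlex_total_on_lists:
  assumes "total_on A r" "u \<in> lists A" "v \<in> lists A" "u \<noteq> v"
  shows "(u, v) \<in> lenlex (r - Id) \<or> (v, u) \<in> lenlex (r - Id)"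
  using assms(2-)
proof (induction u arbitrary: v rule: list.induct)
  case (Cons x u)
  note IH = Cons.IH and prems = Cons.prems
  show ?case
  proof (cases v)
    case (Cons y v')
    have xy: "x \<in> A" "u \<in> lists A" "y \<in> A" "v' \<in> lists A" "x \<noteq> y \<or> u \<noteq> v'"
      using prems Cons by auto
    show ?thesis
    proof (cases "x = y")
      case True
      then show ?thesis using IH[OF xy(2,4)] xy(5) Cons by (auto simp: Cons_lenlex_iff)
    next
      case False
      then have "(x, y) \<in> r - Id \<or> (y, x) \<in> r - Id" using assms(1) xy by (auto simp: total_on_def)
      then show ?thesis using Cons by (auto simp: Cons_lenlex_iff)
    qed
  qed simp
qed simp

lemma lenlex_append_cases:
  assumes "length z1 = length u" "length z2 = length v" "(z1 @ z2, u @ v) \<in> lenlex R"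
  shows "(z1, u) \<in> lenlex R \<or> z1 = u \<and> (z2, v) \<in> lenlex R"
  using assms by (induction z1 u rule: list_induct2) (auto simp: Cons_lenlex_iff)

section \<open>Regularity of the two languages\<close>

context word_group
begin

lemma norm_sandwich:
  assumes "\<beta> \<in> carrier G" "\<gamma> \<in> carrier G" "g \<in> carrier G" "N \<beta> \<le> K" "N \<gamma> \<le> K"
  shows "N g \<le> N (inv \<gamma> \<otimes> g \<otimes> \<beta>) + 2 * K" "N (inv \<gamma> \<otimes> g \<otimes> \<beta>) \<le> N g + 2 * K"
proof -
  have "g = \<gamma> \<otimes> (inv \<gamma> \<otimes> g \<otimes> \<beta>) \<otimes> inv \<beta>" using assms by (simp add: group_simps)
  then have "N g \<le> N (\<gamma> \<otimes> (inv \<gamma> \<otimes> g \<otimes> \<beta>)) + N (inv \<beta>)"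
    using norm_mult[of "\<gamma> \<otimes> (inv \<gamma> \<otimes> g \<otimes> \<beta>)" "inv \<beta>"] assms by simp
  also have "\<dots> \<le> N \<gamma> + N (inv \<gamma> \<otimes> g \<otimes> \<beta>) + N \<beta>"
    using norm_mult[of \<gamma> "inv \<gamma> \<otimes> g \<otimes> \<beta>"] norm_inv[of \<beta>] assms by simp
  finally show "N g \<le> N (inv \<gamma> \<otimes> g \<otimes> \<beta>) + 2 * K" using assms by simp
  have "N (inv \<gamma> \<otimes> g \<otimes> \<beta>) \<le> N (inv \<gamma> \<otimes> g) + N \<beta>" using norm_mult assms by simp
  also have "\<dots> \<le> N \<gamma> + N g + N \<beta>" using norm_mult[of "inv \<gamma>" g] norm_inv[of \<gamma>] assms by simp
  finally show "N (inv \<gamma> \<otimes> g \<otimes> \<beta>) \<le> N g + 2 * K" using assms by simp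
qed

text \<open>Adding \<open>2 K\<close> keeps the subtraction from being truncated when \<open>u\<close> is geodesic.\<close>

definition profile :: "nat \<Rightarrow> 'a list \<Rightarrow> ('a \<times> 'a \<times> nat) set" where
  "profile K u = {(\<beta>, \<gamma>, N (inv \<gamma> \<otimes> val u \<otimes> \<beta>) + 2 * K - length u) | \<beta> \<gamma>.
     \<beta> \<in> carrier G \<and> \<gamma> \<in> carrier G \<and> N \<beta> \<le> K \<and> N \<gamma> \<le> K}"

text \<open>The norm exceeds \<open>length u\<close> by at most \<open>2 * K\<close>, and the shift
  adds another \<open>2 * K\<close>.\<close>

lemma profile_subset:
  assumes "u \<in> lists X" "N (val u) = length u"
  shows "profile K u \<subseteq> {g \<in> carrier G. N g \<le> K} \<times> {g \<in> carrier G. N g \<le> K} \<times> {..4 * K}"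
  using norm_sandwich(2)[OF _ _ val_closed[OF assms(1)], of _ _ K] assms(2) unfolding profile_def by fastforce

text \<open>A profile is the graph of a function of \<beta> and \<gamma>, so equal profiles have
  equal third entries; without truncation, norm minus length then agrees for \<open>u\<close> and
  \<open>u'\<close>.\<close>

lemma shortcut_cong:
  assumes u: "u \<in> lists X" "N (val u) = length u" and u': "u' \<in> lists X" "N (val u') = length u'"
    and eq: "profile K u = profile K u'" and s: "shortcut K u v"
  shows "shortcut K u' v"
proof -
  obtain \<beta> \<gamma> where b: "\<beta> \<in> carrier G" "\<gamma> \<in> carrier G" "N \<beta> \<le> K" "N \<gamma> \<le> K"
    and l: "N (inv \<gamma> \<otimes> val u \<otimes> \<beta>) + N (inv \<beta> \<otimes> val v \<otimes> \<gamma>) < length u + length v"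
    using s unfolding shortcut_def by blast
  have "(\<beta>, \<gamma>, N (inv \<gamma> \<otimes> val u \<otimes> \<beta>) + 2 * K - length u) \<in> profile K u"
    unfolding profile_def using b by blast
  then have "(\<beta>, \<gamma>, N (inv \<gamma> \<otimes> val u \<otimes> \<beta>) + 2 * K - length u) \<in> profile K u'" unfolding eq .
  then have "N (inv \<gamma> \<otimes> val u \<otimes> \<beta>) + 2 * K - length u = N (inv \<gamma> \<otimes> val u' \<otimes> \<beta>) + 2 * K - length u'"
    unfolding profile_def by blast
  moreover have "length u \<le> N (inv \<gamma> \<otimes> val u \<otimes> \<beta>) + 2 * K"
    using norm_sandwich(1)[OF b(1,2) val_closed[OF u(1)] b(3,4)] u(2) by simp
  moreover have "length u' \<le> N (inv \<gamma> \<otimes> val u' \<otimes> \<beta>) + 2 * K"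
    using norm_sandwich(1)[OF b(1,2) val_closed[OF u'(1)] b(3,4)] u'(2) by simp
  ultimately have "N (inv \<gamma> \<otimes> val u' \<otimes> \<beta>) + N (inv \<beta> \<otimes> val v \<otimes> \<gamma>) < length u' + length v"
    using l by linarith
  then show ?thesis unfolding shortcut_def using b by blast
qed

definition shortlex_least :: "('a \<times> 'a) set \<Rightarrow> 'a list \<Rightarrow> bool" where
  "shortlex_least r w \<longleftrightarrow> (\<forall>v\<in>lists X. val v = val w \<longrightarrow> (v, w) \<notin> lenlex (r - Id))"

text \<open>Only the end points of \<open>z\<close> and \<open>u\<close> have to be close; when
  \<open>z\<close> and \<open>u\<close> extend to geodesics with a common end, fellow travelling
  supplies this. Equal length suffices for comparison because a geodesic word has no shorter
  competitor.\<close>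

definition rivals :: "('a \<times> 'a) set \<Rightarrow> nat \<Rightarrow> 'a list \<Rightarrow> 'a set" where
  "rivals r K u = {\<beta> \<in> carrier G. N \<beta> \<le> K \<and>
     (\<exists>z\<in>lists X. length z = length u \<and> (z, u) \<in> lenlex (r - Id) \<and> val z = val u \<otimes> \<beta>)}"

text \<open>A smaller word for the same element has the same length and is split at
  \<open>length u\<close>. Either its first part is smaller than \<open>u\<close>, and their
  difference is a rival \<beta> continued by a word as long as \<open>v\<close>, or the first parts
  agree and \<open>v\<close> can be improved. So \<open>u\<close> matters only through its
  rivals.\<close>

lemma shortlex_least_append_iff:
  assumes sl: "slim \<delta>" and K: "6 * \<delta> \<le> K" and u: "u \<in> lists X" and v: "v \<in> lists X"
    and geo: "N (val (u @ v)) = length (u @ v)"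
  shows "shortlex_least r (u @ v) \<longleftrightarrow>
    shortlex_least r v \<and> (\<forall>\<beta>\<in>rivals r K u. length v < N (inv \<beta> \<otimes> val v))"
proof (intro iffI conjI ballI)
  assume least: "shortlex_least r (u @ v)"
  have irr: "irrefl (r - Id)" by (simp add: irrefl_def)
  show "shortlex_least r v"
    unfolding shortlex_least_def
  proof (intro ballI impI notI)
    fix v' assume v': "v' \<in> lists X" "val v' = val v" "(v', v) \<in> lenlex (r - Id)"
    then have "(u @ v', u @ v) \<in> lenlex (r - Id)" using irr by simp
    moreover have "u @ v' \<in> lists X" "val (u @ v') = val (u @ v)" using u v v' by (simp_all add: val_append)
    ultimately show False using least unfolding shortlex_least_def by blast
  qed
  fix \<beta> assume "\<beta> \<in> rivals r K u"
  then obtain z where b: "\<beta> \<in> carrier G" and z: "z \<in> lists X" "length z = length u"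
    "(z, u) \<in> lenlex (r - Id)" "val z = val u \<otimes> \<beta>" unfolding rivals_def by blast
  obtain q where q: "q \<in> lists X" "val q = inv \<beta> \<otimes> val v" "length q = N (inv \<beta> \<otimes> val v)"
    using norm_word[of "inv \<beta> \<otimes> val v"] b v by auto
  have zq: "z @ q \<in> lists X" "val (z @ q) = val (u @ v)"
    using z q b u v by (simp_all add: val_append group_simps)
  then have "length (u @ v) \<le> length (z @ q)" using norm_le[OF zq(1)] geo by simp
  then have "length v \<le> length q" using z by simp
  \<comment> \<open>With equal lengths \<open>z @ q\<close> would precede \<open>u @ v\<close>,
    already because of the first parts.\<close>
  moreover have "length q \<noteq> length v"
    using lenlex_append1[OF z(3), of q v] zq least unfolding shortlex_least_def by blast
  ultimately show "length v < N (inv \<beta> \<otimes> val v)" using q by simp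
next
  assume H: "shortlex_least r v \<and> (\<forall>\<beta>\<in>rivals r K u. length v < N (inv \<beta> \<otimes> val v))"
  show "shortlex_least r (u @ v)"
    unfolding shortlex_least_def
  proof (intro ballI impI notI)
    fix z assume z: "z \<in> lists X" "val z = val (u @ v)" "(z, u @ v) \<in> lenlex (r - Id)"
    have uv: "u @ v \<in> lists X" using u v by simp
    have "length z \<le> length (u @ v)" using lenlex_length[OF z(3)] .
    moreover have "length (u @ v) \<le> length z" using norm_le[OF z(1)] z(2) geo by simp
    ultimately have lz: "length z = length (u @ v)" by simp
    define z1 z2 where "z1 = take (length u) z" and "z2 = drop (length u) z"
    have zz: "z = z1 @ z2" "length z1 = length u" "length z2 = length v" using lz by (simp_all add: z1_def z2_def)
    have zl: "z1 \<in> lists X" "z2 \<in> lists X" using z(1) zz(1) by auto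
    have val: "val z1 \<otimes> val z2 = val u \<otimes> val v" using z(2) zz(1) zl u v by (simp add: val_append)
    consider "(z1, u) \<in> lenlex (r - Id)" | "z1 = u" "(z2, v) \<in> lenlex (r - Id)"
      using lenlex_append_cases[OF zz(2,3)] z(3) zz(1) by blast
    then show False
    proof cases
      case 1
      define \<beta> where "\<beta> = inv (val u) \<otimes> val z1"
      have b: "\<beta> \<in> carrier G" using u zl by (simp add: \<beta>_def)
      have gz: "N (val z) = length z" using z(2) geo lz by simp
      \<comment> \<open>The two geodesic words share both end points, so the fellow traveller
        constant is \<open>6 * \<delta>\<close>.\<close>
      have "D (val (u @ v)) (\<one> \<otimes> val z) \<le> 0" using z u v uv by (simp add: dist_self del: append_in_lists_conv)
      then have "D (val (take (length u) (u @ v))) (\<one> \<otimes> val (take (min (length u) (length z)) z)) \<le> 6 * \<delta> + 3 * 0"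
        by (intro geodesic_words_fellow_travel[OF sl uv geo z(1) gz]) simp_all
      moreover have "take (min (length u) (length z)) z = z1" using lz by (simp add: z1_def)
      ultimately have "N \<beta> \<le> K" using K zl by (simp add: \<beta>_def cayley_dist_def)
      moreover have "val z1 = val u \<otimes> \<beta>" using u zl by (simp add: \<beta>_def cancel_inv)
      ultimately have "\<beta> \<in> rivals r K u" unfolding rivals_def using b zl zz 1 by blast
      moreover have "inv \<beta> \<otimes> val v = inv (val z1) \<otimes> (val u \<otimes> val v)"
        using u v zl by (simp add: \<beta>_def group_simps)
      then have "inv \<beta> \<otimes> val v = val z2" unfolding val[symmetric] using zl by (simp add: inv_cancel)
      ultimately show False using H norm_le[OF zl(2)] zz by fastforce
    next
      case 2
      then have "val z2 = val v" using val u v zl by simp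
      then show False using H 2 zl unfolding shortlex_least_def by blast
    qed
  qed
qed

text \<open>Removes the definite description: a least word exists because the order on a finite
  alphabet is well-founded, by totality it precedes all other words for its element, and it is
  geodesic since length is compared first.\<close>

lemma ConjMinLenSL_eq:
  assumes r: "linear_order_on X r"
  shows "ConjMinLenSL G X r = {w \<in> ConjGeo G X. shortlex_least r w}"
proof -
  have po: "partial_order_on X r" and tot: "total_on X r" using r by (auto simp: linear_order_on_def)
  have "finite r" using partial_order_onD(4)[OF po] finite_generators finite_subset by blast
  then have wf: "wf (lenlex (r - Id))" using partial_order_on_well_order_on[OF _ po] by blast
  have rep: "shortlex_rep G X r (val w) = w" if w: "w \<in> lists X" "shortlex_least r w" for w
    unfolding shortlex_rep_def
  proof (rule the_equality)
    show "w \<in> lists X \<and> val w = val w \<and>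
        (\<forall>v\<in>lists X. val v = val w \<and> v \<noteq> w \<longrightarrow> (w, v) \<in> lenlex (r - Id))"
      using w lenlex_total_on_lists[OF tot] unfolding shortlex_least_def by blast
    show "w' = w" if "w' \<in> lists X \<and> val w' = val w \<and>
        (\<forall>v\<in>lists X. val v = val w \<and> v \<noteq> w' \<longrightarrow> (w', v) \<in> lenlex (r - Id))" for w'
      using that w unfolding shortlex_least_def by blast
  qed
  have ex: "\<exists>w\<in>lists X. val w = g \<and> shortlex_least r w" if g: "g \<in> carrier G" for g
  proof -
    obtain w0 where "w0 \<in> {w \<in> lists X. val w = g}" using word_ex[OF g] by blast
    then obtain w where "w \<in> {w \<in> lists X. val w = g}"
      "\<And>v. (v, w) \<in> lenlex (r - Id) \<Longrightarrow> v \<notin> {w \<in> lists X. val w = g}"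
      by (rule wfE_min[OF wf]) blast
    then show ?thesis unfolding shortlex_least_def by blast
  qed
  have len: "length w = N (val w)" if w: "w \<in> lists X" "shortlex_least r w" for w
  proof -
    obtain z where z: "z \<in> lists X" "val z = val w" "length z = N (val w)" using norm_word[OF val_closed[OF w(1)]] .
    then have "(z, w) \<notin> lenlex (r - Id)" using w unfolding shortlex_least_def by blast
    then show ?thesis using z norm_le[OF w(1)] by (auto simp: lenlex_conv)
  qed
  show ?thesis
  proof (intro equalityI subsetI)
    fix w assume "w \<in> ConjMinLenSL G X r"
    then obtain g where g: "g \<in> carrier G" "N g = conj_norm G X g" "w = shortlex_rep G X r g"
      unfolding ConjMinLenSL_def by blast
    obtain v where v: "v \<in> lists X" "val v = g" "shortlex_least r v" using ex[OF g(1)] by blast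
    then have "w = v" using rep g by blast
    then show "w \<in> {w \<in> ConjGeo G X. shortlex_least r w}" using v g len[OF v(1,3)] by (simp add: ConjGeo_def)
  next
    fix w assume "w \<in> {w \<in> ConjGeo G X. shortlex_least r w}"
    then have w: "w \<in> lists X" "length w = conj_norm G X (val w)" "shortlex_least r w" by (auto simp: ConjGeo_def)
    then have "w = shortlex_rep G X r (val w)" "N (val w) = conj_norm G X (val w)"
      using rep[OF w(1,3)] len[OF w(1,3)] by simp_all
    then show "w \<in> ConjMinLenSL G X r" unfolding ConjMinLenSL_def using val_closed[OF w(1)] by blast
  qed
qed

lemma norm_eq_length_if_ConjGeo:
  assumes "u \<in> lists X" "v \<in> lists X" "u @ v \<in> ConjGeo G X"
  shows "N (val (u @ v)) = length (u @ v)" "N (val u) = length u"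
proof -
  have uv: "u @ v \<in> lists X" using assms by simp
  have "length (u @ v) \<le> N (inv \<one> \<otimes> val (u @ v) \<otimes> \<one>)" using assms(3) ConjGeo_iff[OF uv] by blast
  then show *: "N (val (u @ v)) = length (u @ v)" using norm_le[OF uv] val_closed[OF uv] by simp
  show "N (val u) = length u" using norm_geodesic_factor[of "[]" u v] * assms by simp
qed

lemma regular_conjugacy_languages:
  assumes sl: "slim \<delta>" and r: "linear_order_on X r"
  shows "regular_language X (ConjGeo G X)" "regular_language X (ConjMinLenSL G X r)"
proof -
  obtain K0 where K0: "\<And>u v. \<lbrakk>u \<in> lists X; v \<in> lists X\<rbrakk> \<Longrightarrow> u @ v \<in> ConjGeo G X \<longleftrightarrow> \<not> shortcut K0 u v"
    using shortcut_criterion[OF sl] by blast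
  define K where "K = 6 * \<delta>"
  \<comment> \<open>All non-geodesic words share the value \<open>None\<close>, as none of their
    extensions lies in either language. For geodesic words both recorded sets are drawn from finite
    collections.\<close>
  define \<phi> where "\<phi> u = (if N (val u) = length u then Some (profile K0 u, rivals r K u) else None)" for u
  define B where "B k = {g \<in> carrier G. N g \<le> k}" for k
  have fin: "finite (\<phi> ` lists X)"
  proof (rule finite_subset)
    show "\<phi> ` lists X \<subseteq> insert None (Some ` (Pow (B K0 \<times> B K0 \<times> {..4 * K0}) \<times> Pow (B K)))"
    proof (rule image_subsetI)
      fix u assume u: "u \<in> lists X"
      have "rivals r K u \<in> Pow (B K)" unfolding B_def rivals_def by blast
      moreover have "profile K0 u \<in> Pow (B K0 \<times> B K0 \<times> {..4 * K0})" if "N (val u) = length u"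
        using profile_subset[OF u that] unfolding B_def by blast
      ultimately show "\<phi> u \<in> insert None (Some ` (Pow (B K0 \<times> B K0 \<times> {..4 * K0}) \<times> Pow (B K)))"
        unfolding \<phi>_def by simp
    qed
    show "finite (insert None (Some ` (Pow (B K0 \<times> B K0 \<times> {..4 * K0}) \<times> Pow (B K))))"
      using finite_ball unfolding B_def by simp
  qed
  have split: "N (val u') = length u' \<and> profile K0 u = profile K0 u' \<and> rivals r K u = rivals r K u'"
    if "\<phi> u = \<phi> u'" "N (val u) = length u" for u u'
    using that unfolding \<phi>_def by (simp split: if_splits)
  have geo: "u' @ v \<in> ConjGeo G X"
    if l: "u \<in> lists X" "u' \<in> lists X" "v \<in> lists X" and eq: "\<phi> u = \<phi> u'" and uv: "u @ v \<in> ConjGeo G X" for u u' v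
  proof -
    have gu: "N (val u) = length u" using norm_eq_length_if_ConjGeo(2)[OF l(1,3) uv] .
    have s: "N (val u') = length u'" "profile K0 u' = profile K0 u" using split[OF eq gu] by simp_all
    have "\<not> shortcut K0 u' v"
      using shortcut_cong[OF l(2) s(1) l(1) gu s(2)] uv K0[OF l(1,3)] by blast
    then show ?thesis using K0[OF l(2,3)] by blast
  qed
  show "regular_language X (ConjGeo G X)"
    by (rule regular_language_if_finite_index[OF _ fin geo]) (auto simp: ConjGeo_def)
  show "regular_language X (ConjMinLenSL G X r)"
    unfolding ConjMinLenSL_eq[OF r]
  proof (rule regular_language_if_finite_index[OF _ fin])
    show "{w \<in> ConjGeo G X. shortlex_least r w} \<subseteq> lists X" by (auto simp: ConjGeo_def)
    fix u u' v assume l: "u \<in> lists X" "u' \<in> lists X" "v \<in> lists X" and eq: "\<phi> u = \<phi> u'"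
      and "u @ v \<in> {w \<in> ConjGeo G X. shortlex_least r w}"
    then have uv: "u @ v \<in> ConjGeo G X" "shortlex_least r (u @ v)" by auto
    have u'v: "u' @ v \<in> ConjGeo G X" by (rule geo[OF l eq uv(1)])
    note n = norm_eq_length_if_ConjGeo[OF l(1,3) uv(1)] norm_eq_length_if_ConjGeo(1)[OF l(2,3) u'v]
    have "rivals r K u = rivals r K u'" using split[OF eq n(2)] by blast
    then have "shortlex_least r (u' @ v)"
      using shortlex_least_append_iff[OF sl _ l(1,3) n(1), of K] uv(2)
        shortlex_least_append_iff[OF sl _ l(2,3) n(3), of K] by (simp add: K_def)
    then show "u' @ v \<in> {w \<in> ConjGeo G X. shortlex_least r w}" using u'v by simp
  qed
qed

end

theorem theorem3p1:
  fixes G :: "('a, 'b) monoid_scheme" and X :: "'a set" and r :: "('a \<times> 'a) set"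
  assumes "word_hyperbolic G"
    and "fin_inv_gen_set G X"
    and "linear_order_on X r"
  shows "regular_language X (ConjGeo G X) \<and> regular_language X (ConjMinLenSL G X r)"
proof -
  obtain Y \<delta> where "group G" and Y: "fin_inv_gen_set G Y" "cayley_slim_triangles G Y \<delta>"
    using assms(1) unfolding word_hyperbolic_def by blast
  interpret word_group G X
    using \<open>group G\<close> assms(2) by (simp add: word_group_def word_group_axioms_def)
  obtain \<delta>' where "slim \<delta>'" using slim_change_generators[OF Y] by blast
  then show ?thesis using regular_conjugacy_languages assms(3) by blast
qed

end
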